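(* Assume the departure times are distributed according to a probability measure $\mu$ on $[0,+\infty]$ with $\mu([0,1))=0$. For $d\ge 2$, the loss of the greedy algorithm satisfies $$L_{\mathrm{GDY}}\le e^{-\frac{d}{2\log(2)}}.$$
   Context: Dynamic matching market on the time window $[0,T]$: agents arrive according to a Poisson process of rate $m$ and enter the pool (initially empty). Fix a density parameter $d>0$ and set $p=d/m$; when an agent arrives she is compatible with each agent currently in the pool independently with probability $p$. Each agent $v_i$ has an independent maximum sojourn time $X_i\sim\mu$; an agent arriving at time $t$ still unmatched at time $t+X_i$ leaves unmatched (perishes). Greedy algorithm GDY: when an agent arrives, if the pool contains a compatible agent she is immediately matched to one of them chosen uniformly at random and both leave; otherwise she joins the pool. Let $a_{[0,T]}$ be the number of arrivals in $[0,T]$, $\mathrm{GDY}(m,T)$ the set of agents matched until time $T$, $z_T$ the pool size at time $T$. The loss is $L_{\mathrm{GDY}}(m,T)=\frac{\mathbb{E}[a_{[0,T]}-|\mathrm{GDY}(m,T)|-z_T]}{mT}$ and $L_{\mathrm{GDY}}=\limsup_{m,T\to\infty}L_{\mathrm{GDY}}(m,T)$, with $d$ and $\mu$ fixed. $\log$ is the natural logarithm. *)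

theory Defs
  imports "HOL-Probability.Probability"
begin

text \<open>
  Agents are numbered \<open>0, 1, 2, \<dots>\<close> in order of arrival. A sample point consists of the
  interarrival times \<open>E\<close>, the maximum sojourn times \<open>X\<close> (possibly infinite), the compatibilities
  \<open>C\<close>, where \<open>C (i, n)\<close> says that agent \<open>n\<close>, on arrival, is compatible with the earlier agent \<open>i\<close>,
  and the seeds \<open>U\<close> with which agent \<open>n\<close> chooses among her compatible agents.
\<close>

type_synonym sample =
  "(nat \<Rightarrow> real) \<times> (nat \<Rightarrow> ennreal) \<times> (nat \<times> nat \<Rightarrow> bool) \<times> (nat \<Rightarrow> real)"

text \<open>
  A Poisson process of rate \<open>m\<close> is the counting process of i.i.d. exponential interarrival times.
  The parameter of \<^const>\<open>bernoulli_pmf\<close> is clamped to \<open>[0, 1]\<close>, which matters only for \<open>m < d\<close>.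
\<close>

definition market_space :: "real \<Rightarrow> ennreal measure \<Rightarrow> real \<Rightarrow> sample measure" where
  "market_space d \<mu> m =
     (\<Pi>\<^sub>M i\<in>UNIV. density lborel (\<lambda>x. ennreal (exponential_density m x))) \<Otimes>\<^sub>M
     (\<Pi>\<^sub>M i\<in>UNIV. \<mu>) \<Otimes>\<^sub>M
     (\<Pi>\<^sub>M ij\<in>UNIV. measure_pmf (bernoulli_pmf (d / m))) \<Otimes>\<^sub>M
     (\<Pi>\<^sub>M i\<in>UNIV. uniform_measure lborel {0..<1})"

definition arrival_time :: "(nat \<Rightarrow> real) \<Rightarrow> nat \<Rightarrow> real" where
  "arrival_time E n = (\<Sum>k\<le>n. E k)"

definition present :: "(nat \<Rightarrow> real) \<Rightarrow> (nat \<Rightarrow> ennreal) \<Rightarrow> real \<Rightarrow> nat set \<Rightarrow> nat set" where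
  "present E X t P = {i \<in> P. ennreal t < ennreal (arrival_time E i) + X i}"

text \<open>
  For \<open>u\<close> uniform on \<open>[0, 1)\<close> and \<open>K\<close> finite and nonempty, this is a uniform element of \<open>K\<close>.
\<close>

definition uniform_choice :: "real \<Rightarrow> nat set \<Rightarrow> nat" where
  "uniform_choice u K = sorted_list_of_set K ! nat \<lfloor>u * real (card K)\<rfloor>"

text \<open>
  The pool and the set of matched agents right after the first \<open>n\<close> arrivals have been handled.
  Agents whose sojourn time has run out are removed from the pool when it is next inspected.
\<close>

primrec greedy_state :: "sample \<Rightarrow> nat \<Rightarrow> nat set \<times> nat set" where
  "greedy_state \<omega> 0 = ({}, {})"
| "greedy_state \<omega> (Suc n) =
     (let (E, X, C, U) = \<omega>;
          (P, G) = greedy_state \<omega> n;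
          P' = present E X (arrival_time E n) P;
          K = {i \<in> P'. C (i, n)};
          j = uniform_choice (U n) K
      in if K = {} then (insert n P', G) else (P' - {j}, G \<union> {j, n}))"

definition arrivals :: "sample \<Rightarrow> real \<Rightarrow> nat" where
  "arrivals \<omega> T = (case \<omega> of (E, X, C, U) \<Rightarrow> card {n. arrival_time E n \<le> T})"

definition greedy_matched :: "sample \<Rightarrow> real \<Rightarrow> nat set" where
  "greedy_matched \<omega> T = snd (greedy_state \<omega> (arrivals \<omega> T))"

definition greedy_pool :: "sample \<Rightarrow> real \<Rightarrow> nat set" where
  "greedy_pool \<omega> T =
     (case \<omega> of (E, X, C, U) \<Rightarrow> present E X T (fst (greedy_state \<omega> (arrivals \<omega> T))))"

definition greedy_loss_at :: "real \<Rightarrow> ennreal measure \<Rightarrow> real \<Rightarrow> real \<Rightarrow> real" where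
  "greedy_loss_at d \<mu> m T =
     (\<integral>\<omega>. real (arrivals \<omega> T) - real (card (greedy_matched \<omega> T)) - real (card (greedy_pool \<omega> T))
        \<partial>market_space d \<mu> m) / (m * T)"

definition greedy_loss :: "real \<Rightarrow> ennreal measure \<Rightarrow> ereal" where
  "greedy_loss d \<mu> =
     Limsup (at_top \<times>\<^sub>F at_top) (\<lambda>(m, T). ereal (greedy_loss_at d \<mu> m T))"

end

theory Submission
  imports Defs "HOL-Real_Asymp.Real_Asymp"
begin

text \<open>
  Conditionally on all arrival and sojourn times, an arriving agent who finds a pool of size \<open>z\<close> joins
  it with probability \<open>(1 - p)^z \<le> exp (- p z)\<close> and otherwise shrinks it. Hence the drift of the pool
  size is negative above \<open>m ln 2 / d\<close>, and an exponential Lyapunov function shows that the pool exceeds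
  \<open>(ln 2 / d + 2 e) m\<close> only with probability exponentially small in \<open>m\<close>. By symmetry a given member of
  the pool is matched by the next arrival with probability
  \<open>(1 - (1 - p)^z) / z \<ge> (1 - exp (- p z)) / z\<close>; the right-hand side decreases in \<open>z\<close>, so for pools of
  at most this size it is at least about \<open>d / (2 m ln 2)\<close>.

  An agent who perishes has been in the pool for at least one unit of time, during which, up to
  probability \<open>O(1 / m)\<close>, at least \<open>(1 - e) m\<close> agents arrive (Chebyshev). She survives all of them with
  probability about \<open>exp (- d / (2 ln 2))\<close>. Summing over the agents arriving until \<open>T\<close>, of whom there are
  \<open>m T\<close> on average, bounds the loss uniformly in \<open>T\<close>.
\<close>

section \<open>Resampling coordinates of a product measure\<close>

lemma measurable_PiM_combine:
  assumes [measurable]: "f \<in> N \<rightarrow>\<^sub>M PiM UNIV M" "g \<in> N \<rightarrow>\<^sub>M PiM UNIV M"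
  shows "(\<lambda>z i. if i \<in> J then g z i else f z i) \<in> N \<rightarrow>\<^sub>M PiM UNIV M"
proof (rule measurable_PiM_single')
  fix i
  show "(\<lambda>z. if i \<in> J then g z i else f z i) \<in> N \<rightarrow>\<^sub>M M i" by (cases "i \<in> J") simp_all
next
  show "(\<lambda>z i. if i \<in> J then g z i else f z i) \<in> space N \<rightarrow> (\<Pi>\<^sub>E i\<in>UNIV. space (M i))"
    using measurable_space[OF assms(1)] measurable_space[OF assms(2)] by (auto simp: space_PiM PiE_iff)
qed

text \<open>On a cylinder over a finite index set \<open>L\<close> the preimage is a rectangle: the
  old point is constrained on \<open>L - J\<close>, the fresh one on \<open>L \<inter> J\<close>.
  The two finite products multiply to the product over \<open>L\<close>, and cylinders determine the
  measure.\<close>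

lemma distr_PiM_resample:
  fixes M :: "'i \<Rightarrow> 'a measure"
  assumes M: "\<And>i. prob_space (M i)"
  shows "distr (PiM UNIV M \<Otimes>\<^sub>M PiM UNIV M) (PiM UNIV M) (\<lambda>(x, y) i. if i \<in> J then y i else x i) = PiM UNIV M"
proof -
  interpret product_prob_space M UNIV
    by (simp add: product_prob_space_def product_prob_space_axioms_def product_sigma_finite_def M
        prob_space_imp_sigma_finite)
  let ?r = "\<lambda>(x, y) i. if i \<in> J then y i else x i"
  have r: "?r \<in> PiM UNIV M \<Otimes>\<^sub>M PiM UNIV M \<rightarrow>\<^sub>M PiM UNIV M"
    using measurable_PiM_combine[OF measurable_fst measurable_snd, where J = J]
    by (simp add: case_prod_beta')
  show ?thesis
  proof (rule PiM_eq)
    fix L F assume L: "finite L" and F: "\<And>j. j \<in> L \<Longrightarrow> F j \<in> sets (M j)"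
    let ?A = "\<lambda>L. {x \<in> space (PiM UNIV M). \<forall>i\<in>L. x i \<in> F i}"
    have emb: "prod_emb UNIV M L (\<Pi>\<^sub>E j\<in>L. F j) = ?A L"
      by (auto simp: prod_emb_def space_PiM Pi_iff)
    have A: "?A L' \<in> sets (PiM UNIV M)" if "L' \<subseteq> L" for L'
      using that L F by (intro sets.sets_Collect_finite_All sets_Collect_single') (auto intro: finite_subset)
    have "?r -` ?A L \<inter> space (PiM UNIV M \<Otimes>\<^sub>M PiM UNIV M) = ?A (L - J) \<times> ?A (L \<inter> J)"
      by (auto simp: space_pair_measure space_PiM PiE_iff split: if_splits)
    then have "emeasure (distr (PiM UNIV M \<Otimes>\<^sub>M PiM UNIV M) (PiM UNIV M) ?r) (?A L)
        = emeasure (PiM UNIV M) (?A (L - J)) * emeasure (PiM UNIV M) (?A (L \<inter> J))"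
      using A[of L] A[of "L - J"] A[of "L \<inter> J"]
      by (simp only: emeasure_distr[OF r] P.emeasure_pair_measure_Times Diff_subset Int_lower1 subset_refl)
    also have "\<dots> = (\<Prod>i\<in>L - J. emeasure (M i) (F i)) * (\<Prod>i\<in>L \<inter> J. emeasure (M i) (F i))"
      using L F by (subst (1 2) emeasure_PiM_Collect) auto
    also have "\<dots> = (\<Prod>i\<in>L. emeasure (M i) (F i))"
      by (subst prod.union_disjoint[symmetric]) (use L in \<open>auto intro!: prod.cong\<close>)
    finally show "emeasure (distr (PiM UNIV M \<Otimes>\<^sub>M PiM UNIV M) (PiM UNIV M) ?r)
        (prod_emb UNIV M L (\<Pi>\<^sub>E j\<in>L. F j)) = (\<Prod>j\<in>L. emeasure (M j) (F j))"
      unfolding emb .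
  qed simp
qed

text \<open>Independence in integral form: the inner integral plays the part of the conditional
  expectation given the coordinates outside \<open>J\<close>. It serves both for the draws of a
  single agent and for a block of interarrival times.\<close>

lemma nn_integral_PiM_resample:
  assumes M: "\<And>i. prob_space (M i)" and f: "f \<in> borel_measurable (PiM UNIV M)"
  shows "(\<integral>\<^sup>+x. f x \<partial>PiM UNIV M)
    = (\<integral>\<^sup>+x. \<integral>\<^sup>+y. f (\<lambda>i. if i \<in> J then y i else x i) \<partial>PiM UNIV M \<partial>PiM UNIV M)"
proof -
  interpret P: prob_space "PiM UNIV M" by (intro prob_space_PiM M)
  let ?r = "\<lambda>(x, y) i. if i \<in> J then y i else x i"
  have r: "?r \<in> PiM UNIV M \<Otimes>\<^sub>M PiM UNIV M \<rightarrow>\<^sub>M PiM UNIV M"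
    using measurable_PiM_combine[OF measurable_fst measurable_snd, where J = J]
    by (simp add: case_prod_beta')
  have "(\<integral>\<^sup>+x. f x \<partial>PiM UNIV M)
      = (\<integral>\<^sup>+x. f x \<partial>distr (PiM UNIV M \<Otimes>\<^sub>M PiM UNIV M) (PiM UNIV M) ?r)"
    by (subst distr_PiM_resample[OF M]) simp
  also have "\<dots> = (\<integral>\<^sup>+z. f (?r z) \<partial>(PiM UNIV M \<Otimes>\<^sub>M PiM UNIV M))"
    using f by (intro nn_integral_distr[OF r]) simp
  also have "\<dots> = (\<integral>\<^sup>+x. \<integral>\<^sup>+y. f (\<lambda>i. if i \<in> J then y i else x i) \<partial>PiM UNIV M \<partial>PiM UNIV M)"
    using P.nn_integral_fst[OF measurable_compose[OF r f]] by simp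
  finally show ?thesis .
qed

section \<open>Uniform choice among the compatible agents\<close>

lemma sum_Pow_card:
  fixes f :: "nat \<Rightarrow> real"
  assumes "finite F"
  shows "(\<Sum>B\<in>Pow F. f (card B)) = (\<Sum>k\<le>card F. real (card F choose k) * f k)"
proof -
  have "(\<Sum>B\<in>Pow F. f (card B)) = (\<Sum>k\<le>card F. \<Sum>B\<in>{B \<in> Pow F. card B = k}. f (card B))"
    by (rule sum.group[symmetric]) (use assms card_mono in auto)
  also have "\<dots> = (\<Sum>k\<le>card F. real (card F choose k) * f k)"
    by (intro sum.cong refl) (simp add: n_subsets[OF assms])
  finally show ?thesis .
qed

text \<open>For \<open>p\<close> in the unit interval this is the probability that \<open>i\<close>
  is compatible and wins the uniform choice; by symmetry it is the chance of some match, shared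
  among \<open>card S\<close> agents. Algebraically: remove \<open>i\<close>, group by cardinality,
  absorb \<open>1 / Suc k\<close> into the binomial coefficient, and recognise the binomial theorem
  without its zeroth term.\<close>

lemma sum_subsets_containing:
  fixes p :: real
  assumes S: "finite S" "i \<in> S"
  shows "(\<Sum>A | A \<subseteq> S \<and> i \<in> A. p ^ card A * (1 - p) ^ (card S - card A) / card A)
    = (1 - (1 - p) ^ card S) / card S"
proof -
  define F where "F = S - {i}"
  define N where "N = card F"
  have cS: "card S = Suc N"
    using card_Suc_Diff1[OF S] by (simp only: N_def F_def)
  have F: "finite F" "i \<notin> F" "S = insert i F" using S by (auto simp: F_def)
  have "(\<Sum>A | A \<subseteq> S \<and> i \<in> A. p ^ card A * (1 - p) ^ (card S - card A) / card A)
      = (\<Sum>B\<in>Pow F. p ^ Suc (card B) * (1 - p) ^ (N - card B) / Suc (card B))"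
  proof (rule sum.reindex_bij_witness[of _ "insert i" "\<lambda>A. A - {i}"])
    fix A assume A: "A \<in> {A. A \<subseteq> S \<and> i \<in> A}"
    then have "finite A" using S finite_subset by auto
    then have "card A = Suc (card (A - {i}))" using A card_Suc_Diff1[of A i] by simp
    then show "p ^ Suc (card (A - {i})) * (1 - p) ^ (N - card (A - {i})) / Suc (card (A - {i}))
        = p ^ card A * (1 - p) ^ (card S - card A) / card A"
      unfolding cS by (simp only: diff_Suc_Suc)
  qed (use F in auto)
  also have "\<dots> = (\<Sum>k\<le>N. real (N choose k) * (p ^ Suc k * (1 - p) ^ (N - k) / Suc k))"
    unfolding N_def by (rule sum_Pow_card[OF F(1)])
  also have "\<dots> = (\<Sum>k\<le>N. real (Suc N choose Suc k) * p ^ Suc k * (1 - p) ^ (Suc N - Suc k)) / Suc N"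
    unfolding sum_divide_distrib
  proof (rule sum.cong[OF refl])
    fix k
    have "real (Suc k) * real (Suc N choose Suc k) = real (Suc N) * real (N choose k)"
      using Suc_times_binomial_eq[of N k] by (metis of_nat_mult mult.commute)
    then have eq: "real (N choose k) = real (Suc k) * real (Suc N choose Suc k) / real (Suc N)"
      by (simp add: field_simps del: binomial_Suc_Suc)
    show "real (N choose k) * (p ^ Suc k * (1 - p) ^ (N - k) / Suc k)
        = real (Suc N choose Suc k) * p ^ Suc k * (1 - p) ^ (Suc N - Suc k) / Suc N"
      unfolding eq by (simp del: binomial_Suc_Suc of_nat_Suc)
  qed
  also have "(\<Sum>k\<le>N. real (Suc N choose Suc k) * p ^ Suc k * (1 - p) ^ (Suc N - Suc k))
      = (\<Sum>k\<le>Suc N. real (Suc N choose k) * p ^ k * (1 - p) ^ (Suc N - k)) - (1 - p) ^ Suc N"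
    by (subst sum.atMost_Suc_shift) simp
  also have "(\<Sum>k\<le>Suc N. real (Suc N choose k) * p ^ k * (1 - p) ^ (Suc N - k)) = 1"
    using binomial_ring[of p "1 - p" "Suc N"] by simp
  finally show ?thesis by (simp add: cS)
qed

lemma measurable_uniform_choice [measurable]: "(\<lambda>u. uniform_choice u K) \<in> borel \<rightarrow>\<^sub>M count_space UNIV"
  unfolding uniform_choice_def by measurable

text \<open>If \<open>i\<close> has rank \<open>l\<close> in \<open>A\<close>, every seed in an
  interval of length \<open>1 / card A\<close> starting at \<open>l / card A\<close> selects it. A
  lower bound is the direction that later bounds survival from above.\<close>

lemma measure_uniform_choice_ge:
  assumes A: "finite A" "i \<in> A"
  shows "measure (uniform_measure lborel {0..<1}) {u. uniform_choice u A = i} \<ge> 1 / card A"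
proof -
  let ?c = "card A"
  have c: "?c > 0" using A card_gt_0_iff by blast
  obtain l where l: "l < ?c" "sorted_list_of_set A ! l = i"
    using A by (metis in_set_conv_nth set_sorted_list_of_set length_sorted_list_of_set)
  have m: "{u. uniform_choice u A = i} \<in> sets borel"
    using measurable_sets[OF measurable_uniform_choice, of "{i}" A] by (simp add: vimage_def)
  interpret U: prob_space "uniform_measure lborel {0..<1::real}"
    by (rule prob_space_uniform_measure) auto
  have sub: "{real l / ?c ..< (real l + 1) / ?c} \<subseteq> {0..<1} \<inter> {u. uniform_choice u A = i}"
  proof
    fix u assume "u \<in> {real l / ?c ..< (real l + 1) / ?c}"
    then have u: "real l \<le> u * ?c" "u * ?c < real l + 1"
      using c by (auto simp: field_simps)
    then have "\<lfloor>u * ?c\<rfloor> = int l" by linarith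
    then have "uniform_choice u A = i" using l by (simp add: uniform_choice_def)
    moreover have "0 \<le> u * ?c" "u * ?c < 1 * real ?c"
      using u(1) order.strict_trans2[OF u(2), of ?c] l by auto
    then have "0 \<le> u" "u < 1" using c by (auto simp: zero_le_mult_iff)
    ultimately show "u \<in> {0..<1} \<inter> {u. uniform_choice u A = i}" by simp
  qed
  have "ennreal (1 / ?c) = emeasure lborel {real l / ?c ..< (real l + 1) / ?c}"
    using c by (subst emeasure_lborel_Ico) (auto simp: divide_simps)
  also have "\<dots> \<le> emeasure lborel ({0..<1} \<inter> {u. uniform_choice u A = i})"
    by (intro emeasure_mono sub) (use m in auto)
  also have "\<dots> = emeasure (uniform_measure lborel {0..<1}) {u. uniform_choice u A = i}"
    using m by (subst emeasure_uniform_measure) (auto simp: divide_ennreal_def)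
  also have "\<dots> = ennreal (U.prob {u. uniform_choice u A = i})"
    by (rule U.emeasure_eq_measure)
  finally show ?thesis by (simp add: ennreal_le_iff)
qed

lemma uniform_choice_in:
  assumes "finite K" "K \<noteq> {}" "0 \<le> u" "u < 1"
  shows "uniform_choice u K \<in> K"
proof -
  have c: "card K > 0" using assms card_gt_0_iff by blast
  have "u * card K < 1 * real (card K)" using assms c by (intro mult_strict_right_mono) auto
  moreover have "0 \<le> u * card K" using assms by simp
  ultimately have "nat \<lfloor>u * card K\<rfloor> < card K" by linarith
  then show ?thesis unfolding uniform_choice_def
    using assms(1) by (metis nth_mem length_sorted_list_of_set set_sorted_list_of_set)
qed

section \<open>The pool as a random set\<close>

text \<open>The matched set never feeds back into the pool, so the pool has a recursion of its own.
  The pair \<open>w\<close> bundles compatibilities and seeds, the randomness that remains once all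
  times are fixed.\<close>

primrec pool :: "(nat \<Rightarrow> real) \<Rightarrow> (nat \<Rightarrow> ennreal) \<Rightarrow> (nat \<times> nat \<Rightarrow> bool) \<times> (nat \<Rightarrow> real) \<Rightarrow> nat \<Rightarrow> nat set"
  where
  "pool E X w 0 = {}"
| "pool E X w (Suc n) =
     (let S = present E X (arrival_time E n) (pool E X w n);
          K = {i \<in> S. fst w (i, n)}
      in if K = {} then insert n S else S - {uniform_choice (snd w n) K})"

lemma fst_greedy_state: "fst (greedy_state (E, X, w) n) = pool E X w n"
  by (induction n) (auto simp: Let_def case_prod_beta)

lemma present_subset: "present E X t P \<subseteq> P"
  by (auto simp: present_def)

lemma pool_subset: "pool E X w n \<subseteq> {..<n}"
proof (induction n)
  case (Suc n)
  then have "present E X (arrival_time E n) (pool E X w n) \<subseteq> {..<n}"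
    using present_subset by blast
  then show ?case by (auto simp: Let_def)
qed simp

lemma finite_pool: "finite (pool E X w n)"
  by (rule finite_subset[OF pool_subset]) simp

text \<open>Adaptedness: the draws of agent \<open>n\<close> and of later agents do not influence
  the pool that agent \<open>n\<close> meets.\<close>

lemma pool_cong:
  assumes "\<And>i k. k < n \<Longrightarrow> fst w (i, k) = fst w' (i, k)" "\<And>k. k < n \<Longrightarrow> snd w k = snd w' k"
  shows "pool E X w n = pool E X w' n"
  using assms by (induction n) (auto simp: Let_def)

section \<open>Measurability of the pool\<close>

text \<open>A subset of a finite set is fixed by finitely many membership predicates, and there are
  only finitely many possible values.\<close>

lemma measurable_finite_set_valued:
  assumes F: "finite F" and sub: "\<And>x. x \<in> space M \<Longrightarrow> S x \<subseteq> F"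
    and m: "\<And>i. i \<in> F \<Longrightarrow> Measurable.pred M (\<lambda>x. i \<in> S x)"
  shows "S \<in> M \<rightarrow>\<^sub>M count_space (Pow F)"
proof (subst measurable_count_space_eq2)
  show "finite (Pow F)" using F by simp
  have "S -` {A} \<inter> space M \<in> sets M" if A: "A \<in> Pow F" for A
  proof -
    have "S x = A \<longleftrightarrow> (\<forall>i\<in>F. i \<in> S x \<longleftrightarrow> i \<in> A)" if "x \<in> space M" for x
      using sub[OF that] A by blast
    then have "S -` {A} \<inter> space M = {x \<in> space M. \<forall>i\<in>F. i \<in> S x \<longleftrightarrow> i \<in> A}"
      by auto
    also have "\<dots> \<in> sets M"
    proof (intro sets.sets_Collect_finite_All F)
      fix i assume "i \<in> F"
      note [measurable] = m[OF this]
      show "{x \<in> space M. i \<in> S x \<longleftrightarrow> i \<in> A} \<in> sets M" by measurable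
    qed
    finally show ?thesis .
  qed
  then show "S \<in> space M \<rightarrow> Pow F \<and> (\<forall>a\<in>Pow F. S -` {a} \<inter> space M \<in> sets M)"
    using sub by auto
qed

lemma measurable_arrival_time [measurable]:
  "(\<lambda>E. arrival_time E n) \<in> borel_measurable (PiM UNIV (\<lambda>_. borel))"
  unfolding arrival_time_def by measurable

text \<open>Only the sigma-algebra of this measure matters. It does not depend on \<open>d\<close>,
  \<open>m\<close> or \<mu>, so measurability is proved once and transferred to the actual
  probability spaces.\<close>

abbreviation "sample_space \<equiv> PiM UNIV (\<lambda>_. borel) \<Otimes>\<^sub>M PiM UNIV (\<lambda>_. borel) \<Otimes>\<^sub>M
  PiM UNIV (\<lambda>_. count_space UNIV) \<Otimes>\<^sub>M PiM UNIV (\<lambda>_. borel) :: sample measure"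

text \<open>In the induction, the surviving pool, the compatible set and the updated pool are each
  measurable for fixed values of the preceding sets. Those sets range over finite collections, so
  they may be substituted one after the other.\<close>

lemma measurable_pool:
  "(\<lambda>(E, X, w). pool E X w n) \<in> sample_space \<rightarrow>\<^sub>M count_space (Pow {..<n})"
proof (induction n)
  case 0
  then show ?case by (simp add: case_prod_beta)
next
  case (Suc n)
  let ?S = "\<lambda>(E, X, w) P. present E X (arrival_time E n) P"
  let ?K = "\<lambda>(E, X, w) S. {i \<in> S. fst w (i, n)}"
  have S: "(\<lambda>\<omega>. ?S \<omega> P) \<in> sample_space \<rightarrow>\<^sub>M count_space (Pow {..<n})" if "P \<in> Pow {..<n}" for P
  proof (rule measurable_finite_set_valued)
    fix i
    show "Measurable.pred sample_space (\<lambda>\<omega>. i \<in> ?S \<omega> P)"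
      unfolding present_def case_prod_beta mem_Collect_eq by measurable
  qed (use that in \<open>auto simp: present_def\<close>)
  have S': "(\<lambda>\<omega>. ?S \<omega> ((\<lambda>(E, X, w). pool E X w n) \<omega>)) \<in> sample_space \<rightarrow>\<^sub>M count_space (Pow {..<n})"
    by (rule measurable_compose_countable'[OF S Suc]) (auto intro: countable_finite)
  have K: "(\<lambda>\<omega>. ?K \<omega> S) \<in> sample_space \<rightarrow>\<^sub>M count_space (Pow {..<n})" if "S \<in> Pow {..<n}" for S
  proof (rule measurable_finite_set_valued)
    fix i
    show "Measurable.pred sample_space (\<lambda>\<omega>. i \<in> ?K \<omega> S)"
      unfolding case_prod_beta mem_Collect_eq by measurable
  qed (use that in auto)
  let ?R = "\<lambda>(E, X, w) S K. if K = {} then insert n S else S - {uniform_choice (snd w n) K}"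
  have R: "(\<lambda>\<omega>. ?R \<omega> S K) \<in> sample_space \<rightarrow>\<^sub>M count_space (Pow {..<Suc n})"
    if "S \<in> Pow {..<n}" for S K
  proof (rule measurable_finite_set_valued)
    fix i
    show "Measurable.pred sample_space (\<lambda>\<omega>. i \<in> ?R \<omega> S K)"
      by (cases "K = {}") (auto simp: case_prod_beta)
  qed (use that in \<open>auto simp: less_Suc_eq split: if_splits\<close>)
  have RK: "(\<lambda>\<omega>. ?R \<omega> S (?K \<omega> S)) \<in> sample_space \<rightarrow>\<^sub>M count_space (Pow {..<Suc n})"
    if "S \<in> Pow {..<n}" for S
    by (rule measurable_compose_countable'[OF R K]) (use that in \<open>auto intro: countable_finite\<close>)
  have "(\<lambda>\<omega>. (\<lambda>S. ?R \<omega> S (?K \<omega> S)) (?S \<omega> ((\<lambda>(E, X, w). pool E X w n) \<omega>)))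
      \<in> sample_space \<rightarrow>\<^sub>M count_space (Pow {..<Suc n})"
    by (rule measurable_compose_countable'[OF RK S']) (auto intro: countable_finite)
  then show ?case by (simp add: Let_def case_prod_beta)
qed

text \<open>
  The interarrival and sojourn times are kept fixed; all bounds on the pool hold uniformly in them.
\<close>

definition choice_space :: "real \<Rightarrow> ((nat \<times> nat \<Rightarrow> bool) \<times> (nat \<Rightarrow> real)) measure" where
  "choice_space p = (\<Pi>\<^sub>M ij\<in>UNIV. measure_pmf (bernoulli_pmf p)) \<Otimes>\<^sub>M
     (\<Pi>\<^sub>M i\<in>UNIV. uniform_measure lborel {0..<1})"

lemma prob_space_unit_uniform: "prob_space (uniform_measure lborel {0..<1::real})"
  by (rule prob_space_uniform_measure) auto

lemma prob_space_choice: "prob_space (choice_space p)"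
  unfolding choice_space_def
  by (intro prob_space_pair prob_space_PiM prob_space_unit_uniform prob_space_measure_pmf)

lemma sets_choice_space [measurable_cong]:
  "sets (choice_space p) = sets (PiM UNIV (\<lambda>_. count_space UNIV) \<Otimes>\<^sub>M PiM UNIV (\<lambda>_. borel))"
  unfolding choice_space_def by (intro sets_pair_measure_cong sets_PiM_cong) auto

lemma space_choice_space: "space (choice_space p) = UNIV"
  by (auto simp: choice_space_def space_pair_measure space_PiM)

lemma measurable_pool_choice:
  "(\<lambda>w. pool E X w n) \<in> choice_space p \<rightarrow>\<^sub>M count_space UNIV"
proof -
  have "(\<lambda>w. (E, X, w)) \<in> choice_space p \<rightarrow>\<^sub>M sample_space"
    by (intro measurable_Pair measurable_const) (auto simp: space_PiM measurable_ident_sets[OF sets_choice_space])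
  from measurable_compose[OF this measurable_pool]
  have "(\<lambda>w. pool E X w n) \<in> choice_space p \<rightarrow>\<^sub>M count_space (Pow {..<n})" by simp
  from measurable_compose[OF this, of "\<lambda>x. x"] show ?thesis by simp
qed

text \<open>
  The pool before the arrival of agent \<open>n\<close> is unaffected by resampling what agent \<open>n\<close> draws, so
  integrating over the fresh copy amounts to conditioning on the past.
\<close>

definition resample :: "nat \<Rightarrow> (nat \<times> nat \<Rightarrow> bool) \<times> (nat \<Rightarrow> real) \<Rightarrow> (nat \<times> nat \<Rightarrow> bool) \<times> (nat \<Rightarrow> real) \<Rightarrow>
    (nat \<times> nat \<Rightarrow> bool) \<times> (nat \<Rightarrow> real)" where
  "resample n w w' = (\<lambda>ij. if ij \<in> UNIV \<times> {n} then fst w' ij else fst w ij,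
     \<lambda>k. if k \<in> {n} then snd w' k else snd w k)"

lemma nn_integral_resample:
  assumes f [measurable]: "f \<in> borel_measurable (choice_space p)"
  shows "(\<integral>\<^sup>+w. f w \<partial>choice_space p) = (\<integral>\<^sup>+w. \<integral>\<^sup>+w'. f (resample n w w') \<partial>choice_space p \<partial>choice_space p)"
proof -
  let ?C = "\<Pi>\<^sub>M ij\<in>(UNIV :: (nat \<times> nat) set). measure_pmf (bernoulli_pmf p)"
  let ?U = "\<Pi>\<^sub>M i\<in>(UNIV :: nat set). uniform_measure lborel {0..<1::real}"
  let ?rC = "\<lambda>C C' ij. if ij \<in> (UNIV::nat set) \<times> {n} then C' ij else (C ij::bool)"
  let ?rU = "\<lambda>U U' k. if k \<in> {n} then U' k else (U k::real)"
  interpret C: prob_space ?C by (intro prob_space_PiM prob_space_measure_pmf)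
  interpret U: prob_space ?U by (intro prob_space_PiM prob_space_unit_uniform)
  interpret CU: pair_prob_space ?C ?U ..
  note C = nn_integral_PiM_resample[OF prob_space_measure_pmf, where J = "UNIV \<times> {n}"]
  note U = nn_integral_PiM_resample[OF prob_space_unit_uniform, where J = "{n}"]
  have f' [measurable]: "f \<in> borel_measurable (?C \<Otimes>\<^sub>M ?U)" using f unfolding choice_space_def .
  note mC [measurable (raw)] = measurable_PiM_combine[where J = "UNIV \<times> {n}" and M = "\<lambda>_. measure_pmf (bernoulli_pmf p)"]
  note mU [measurable (raw)] = measurable_PiM_combine[where J = "{n}" and M = "\<lambda>_. uniform_measure lborel {0..<1::real}"]
  define F where "F w = (\<integral>\<^sup>+w'. f (?rC (fst w) (fst w'), ?rU (snd w) (snd w')) \<partial>(?C \<Otimes>\<^sub>M ?U))" for w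
  have "(\<integral>\<^sup>+w. f w \<partial>choice_space p) = (\<integral>\<^sup>+x. \<integral>\<^sup>+u. f (x, u) \<partial>?U \<partial>?C)"
    unfolding choice_space_def by (rule U.nn_integral_fst[symmetric]) measurable
  also have "\<dots> = (\<integral>\<^sup>+x. \<integral>\<^sup>+x'. \<integral>\<^sup>+u. f (?rC x x', u) \<partial>?U \<partial>?C \<partial>?C)"
    by (rule C) measurable
  also have "\<dots> = (\<integral>\<^sup>+x. \<integral>\<^sup>+x'. \<integral>\<^sup>+u. \<integral>\<^sup>+u'. f (?rC x x', ?rU u u') \<partial>?U \<partial>?U \<partial>?C \<partial>?C)"
    by (intro nn_integral_cong U measurable_compose[OF _ f']) (auto simp: space_PiM)
  \<comment> \<open>Fubini moves the fresh compatibilities inside the old seeds, so that both fresh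
    parts are innermost and together form one draw from the product space.\<close>
  also have "\<dots> = (\<integral>\<^sup>+x. \<integral>\<^sup>+u. \<integral>\<^sup>+x'. \<integral>\<^sup>+u'. f (?rC x x', ?rU u u') \<partial>?U \<partial>?C \<partial>?U \<partial>?C)"
    by (rule nn_integral_cong, rule CU.Fubini'[symmetric]) measurable
  also have "\<dots> = (\<integral>\<^sup>+x. \<integral>\<^sup>+u. F (x, u) \<partial>?U \<partial>?C)"
  proof (intro nn_integral_cong)
    fix x u assume [measurable]: "x \<in> space ?C" "u \<in> space ?U"
    have "(\<lambda>w'. f (?rC x (fst w'), ?rU u (snd w'))) \<in> borel_measurable (?C \<Otimes>\<^sub>M ?U)" by measurable
    from U.nn_integral_fst[OF this]
    show "(\<integral>\<^sup>+x'. \<integral>\<^sup>+u'. f (?rC x x', ?rU u u') \<partial>?U \<partial>?C) = F (x, u)"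
      unfolding F_def by (simp only: fst_conv snd_conv)
  qed
  also have "\<dots> = (\<integral>\<^sup>+w. F w \<partial>(?C \<Otimes>\<^sub>M ?U))"
    unfolding F_def by (rule U.nn_integral_fst) measurable
  finally show ?thesis by (simp only: resample_def F_def choice_space_def)
qed

section \<open>One step of the pool\<close>

lemma emeasure_compatible_set:
  fixes p :: real
  assumes p: "0 \<le> p" "p \<le> 1" and S: "finite S" "A \<subseteq> S"
  shows "emeasure (\<Pi>\<^sub>M ij\<in>UNIV. measure_pmf (bernoulli_pmf p)) {C. {i \<in> S. C (i, n)} = A}
    = ennreal (p ^ card A * (1 - p) ^ (card S - card A))"
    and "{C. {i \<in> S. C (i, n)} = A} \<in> sets (\<Pi>\<^sub>M ij\<in>(UNIV :: (nat \<times> nat) set). measure_pmf (bernoulli_pmf p))"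
proof -
  let ?C = "\<Pi>\<^sub>M ij\<in>(UNIV :: (nat \<times> nat) set). measure_pmf (bernoulli_pmf p)"
  interpret product_prob_space "\<lambda>_ :: nat \<times> nat. measure_pmf (bernoulli_pmf p)" UNIV
    by (simp add: product_prob_space_def product_prob_space_axioms_def product_sigma_finite_def
        prob_space_measure_pmf prob_space_imp_sigma_finite)
  define X where "X ij = (if fst ij \<in> A then {True} else {False})" for ij :: "nat \<times> nat"
  have eq: "{C. {i \<in> S. C (i, n)} = A} = {C \<in> space ?C. \<forall>ij\<in>S \<times> {n}. C ij \<in> X ij}"
    using S(2) by (auto simp: space_PiM X_def split: if_splits)
  have "emeasure ?C {C. {i \<in> S. C (i, n)} = A}
      = (\<Prod>ij\<in>S \<times> {n}. emeasure (measure_pmf (bernoulli_pmf p)) (X ij))"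
    unfolding eq using S(1) by (intro emeasure_PiM_Collect) auto
  also have "\<dots> = (\<Prod>i\<in>S. ennreal (if i \<in> A then p else 1 - p))"
    by (rule prod.reindex_bij_witness[of _ "\<lambda>i. (i, n)" fst])
       (use p in \<open>auto simp: X_def emeasure_pmf_single\<close>)
  also have "\<dots> = ennreal (\<Prod>i\<in>S. if i \<in> A then p else 1 - p)"
    using p by (intro prod_ennreal) auto
  also have "(\<Prod>i\<in>S. if i \<in> A then p else 1 - p) = p ^ card A * (1 - p) ^ (card S - card A)"
    using S by (simp add: prod.If_cases Int_absorb1 card_Diff_subset finite_subset flip: Diff_eq)
  finally show "emeasure ?C {C. {i \<in> S. C (i, n)} = A} = ennreal (p ^ card A * (1 - p) ^ (card S - card A))" .
  show "{C. {i \<in> S. C (i, n)} = A} \<in> sets ?C"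
    unfolding eq using S(1) by (intro sets.sets_Collect_finite_All sets_Collect_single') auto
qed

lemma emeasure_compatible_choice:
  fixes p :: real
  assumes p: "0 \<le> p" "p \<le> 1" and S: "finite S" "A \<subseteq> S" and B: "B \<in> sets borel"
  shows "emeasure (choice_space p) {w. {i \<in> S. fst w (i, n)} = A \<and> snd w n \<in> B}
    = ennreal (p ^ card A * (1 - p) ^ (card S - card A)) * emeasure (uniform_measure lborel {0..<1}) B"
    and "{w. {i \<in> S. fst w (i, n)} = A \<and> snd w n \<in> B} \<in> sets (choice_space p)"
proof -
  let ?C = "\<Pi>\<^sub>M ij\<in>(UNIV :: (nat \<times> nat) set). measure_pmf (bernoulli_pmf p)"
  let ?U = "\<Pi>\<^sub>M i\<in>(UNIV :: nat set). uniform_measure lborel {0..<1::real}"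
  interpret U: product_prob_space "\<lambda>_ :: nat. uniform_measure lborel {0..<1::real}" UNIV
    by (simp add: product_prob_space_def product_prob_space_axioms_def product_sigma_finite_def
        prob_space_unit_uniform prob_space_imp_sigma_finite)
  have eq: "{w. {i \<in> S. fst w (i, n)} = A \<and> snd w n \<in> B}
      = {C. {i \<in> S. C (i, n)} = A} \<times> {u \<in> space ?U. u n \<in> B}"
    by (auto simp: space_PiM)
  have sU: "{u \<in> space ?U. u n \<in> B} \<in> sets ?U"
    using B by (intro sets_Collect_single') auto
  note C = emeasure_compatible_set[OF p S, of n]
  show "{w. {i \<in> S. fst w (i, n)} = A \<and> snd w n \<in> B} \<in> sets (choice_space p)"
    unfolding eq choice_space_def using C(2) sU by (rule pair_measureI)
  show "emeasure (choice_space p) {w. {i \<in> S. fst w (i, n)} = A \<and> snd w n \<in> B}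
    = ennreal (p ^ card A * (1 - p) ^ (card S - card A)) * emeasure (uniform_measure lborel {0..<1}) B"
    unfolding eq choice_space_def
    using B by (simp add: U.P.emeasure_pair_measure_Times C sU U.emeasure_PiM_Collect_single)
qed

lemma emeasure_no_compatible:
  fixes p :: real
  assumes p: "0 \<le> p" "p \<le> 1" and S: "finite S"
  shows "emeasure (choice_space p) {w. {i \<in> S. fst w (i, n)} = {}} = ennreal ((1 - p) ^ card S)"
    and "{w. {i \<in> S. fst w (i, n)} = {}} \<in> sets (choice_space p)"
  using emeasure_compatible_choice[OF p S, of "{}" UNIV n]
    prob_space.emeasure_space_1[OF prob_space_unit_uniform] by simp_all

text \<open>Split by the compatible set \<open>A\<close> containing \<open>i\<close>; the resulting
  events are disjoint and their probabilities are bounded below by the terms of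
  \<open>sum_subsets_containing\<close>. Stating the result through a measurable subset
  \<open>D\<close> avoids having to prove the event itself measurable.\<close>

lemma chosen_event:
  fixes p :: real
  assumes p: "0 \<le> p" "p \<le> 1" and S: "finite S" "i \<in> S"
  shows "\<exists>D\<in>sets (choice_space p).
    D \<subseteq> {w. i \<in> {j \<in> S. fst w (j, n)} \<and> uniform_choice (snd w n) {j \<in> S. fst w (j, n)} = i} \<and>
    measure (choice_space p) D \<ge> (1 - (1 - p) ^ card S) / card S"
proof -
  interpret R: prob_space "choice_space p" by (rule prob_space_choice)
  interpret U: prob_space "uniform_measure lborel {0..<1::real}" by (rule prob_space_unit_uniform)
  let ?B = "\<lambda>A. {u. uniform_choice u A = i}"
  let ?D = "\<lambda>A. {w. {j \<in> S. fst w (j, n)} = A \<and> snd w n \<in> ?B A}"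
  let ?I = "{A. A \<subseteq> S \<and> i \<in> A}"
  have B: "?B A \<in> sets borel" for A
    using measurable_sets[OF measurable_uniform_choice, of "{i}" A] by (simp add: vimage_def)
  have D: "?D A \<in> sets (choice_space p)" if "A \<subseteq> S" for A
    by (rule emeasure_compatible_choice(2)[OF p S(1) that B])
  have mD: "R.prob (?D A) \<ge> p ^ card A * (1 - p) ^ (card S - card A) / card A" if "A \<in> ?I" for A
  proof -
    have A: "A \<subseteq> S" "i \<in> A" "finite A" using that S finite_subset by auto
    have "R.prob (?D A) = p ^ card A * (1 - p) ^ (card S - card A) * U.prob (?B A)"
      unfolding measure_def[of "choice_space p"] emeasure_compatible_choice(1)[OF p S(1) A(1) B]
      using p by (simp add: U.emeasure_eq_measure enn2real_mult)
    also have "\<dots> \<ge> p ^ card A * (1 - p) ^ (card S - card A) * (1 / card A)"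
      using p by (intro mult_left_mono measure_uniform_choice_ge A) auto
    finally show ?thesis by simp
  qed
  have fin: "finite ?I" using S(1) by (intro finite_subset[of ?I "Pow S"]) auto
  have "(1 - (1 - p) ^ card S) / card S = (\<Sum>A\<in>?I. p ^ card A * (1 - p) ^ (card S - card A) / card A)"
    by (rule sum_subsets_containing[OF S, symmetric])
  also have "\<dots> \<le> (\<Sum>A\<in>?I. R.prob (?D A))" by (intro sum_mono mD)
  also have "\<dots> = R.prob (\<Union>A\<in>?I. ?D A)"
    by (rule R.finite_measure_finite_Union[symmetric]) (use fin D in \<open>auto simp: disjoint_family_on_def\<close>)
  finally have "(1 - (1 - p) ^ card S) / card S \<le> R.prob (\<Union>A\<in>?I. ?D A)" .
  moreover have "(\<Union>A\<in>?I. ?D A) \<in> sets (choice_space p)"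
    using fin D by (intro sets.finite_UN) auto
  moreover have "(\<Union>A\<in>?I. ?D A) \<subseteq> {w. i \<in> {j \<in> S. fst w (j, n)} \<and> uniform_choice (snd w n) {j \<in> S. fst w (j, n)} = i}"
    by auto
  ultimately show ?thesis by blast
qed

text \<open>A seed outside the unit interval could index beyond the sorted list, and the chosen
  number need not then be a pool member whose removal shrinks the pool.\<close>

lemma AE_choice_space_unit: "AE w in choice_space p. 0 \<le> snd w n \<and> snd w n < 1"
proof -
  let ?C = "\<Pi>\<^sub>M ij\<in>(UNIV :: (nat \<times> nat) set). measure_pmf (bernoulli_pmf p)"
  let ?U = "\<Pi>\<^sub>M i\<in>(UNIV :: nat set). uniform_measure lborel {0..<1::real}"
  interpret C: prob_space ?C by (intro prob_space_PiM prob_space_measure_pmf)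
  interpret U: prob_space ?U by (intro prob_space_PiM prob_space_unit_uniform)
  interpret CU: pair_prob_space ?C ?U ..
  have "AE x in uniform_measure lborel {0..<1::real}. 0 \<le> x \<and> x < 1"
    by (rule AE_uniform_measureI) auto
  then have "AE u in ?U. 0 \<le> u n \<and> u n < 1"
    by (intro AE_PiM_component prob_space_unit_uniform) auto
  then show ?thesis unfolding choice_space_def
    by (intro CU.AE_pair_measure) auto
qed

definition pool_step :: "nat \<Rightarrow> nat set \<Rightarrow> (nat \<times> nat \<Rightarrow> bool) \<times> (nat \<Rightarrow> real) \<Rightarrow> nat set" where
  "pool_step n S w = (let K = {i \<in> S. fst w (i, n)}
     in if K = {} then insert n S else S - {uniform_choice (snd w n) K})"

lemma pool_resample:
  "pool E X (resample n w w') (Suc n) = pool_step n (present E X (arrival_time E n) (pool E X w n)) w'"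
proof -
  have "pool E X (resample n w w') n = pool E X w n"
    by (rule pool_cong) (auto simp: resample_def)
  moreover have "fst (resample n w w') (i, n) = fst w' (i, n)" "snd (resample n w w') n = snd w' n" for i
    by (simp_all add: resample_def)
  ultimately show ?thesis by (simp only: pool.simps pool_step_def Let_def)
qed

text \<open>The Markov property for fixed times: given the past, the next pool is one step from the
  pool purged of departed agents, driven by an independent draw \<open>w'\<close>.\<close>

lemma nn_integral_pool_Suc:
  fixes f :: "nat set \<Rightarrow> ennreal"
  shows "(\<integral>\<^sup>+w. f (pool E X w (Suc n)) \<partial>choice_space p)
    = (\<integral>\<^sup>+w. \<integral>\<^sup>+w'. f (pool_step n (present E X (arrival_time E n) (pool E X w n)) w')
        \<partial>choice_space p \<partial>choice_space p)"
proof -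
  have "(\<lambda>w. f (pool E X w (Suc n))) \<in> borel_measurable (choice_space p)"
    by (rule measurable_compose[OF measurable_pool_choice]) simp
  from nn_integral_resample[OF this, of n] show ?thesis
    by (simp only: pool_resample)
qed

text \<open>With probability \<open>(1 - p) ^ card S\<close> nobody is compatible and the size grows
  by at most one, costing a factor \<open>b\<close>; otherwise, for almost every seed, it drops by
  exactly one, gaining a factor \<open>1 / b\<close>.\<close>

lemma nn_integral_pool_step_power:
  fixes p b :: real
  assumes p: "0 \<le> p" "p \<le> 1" and S: "finite S" and b: "b \<ge> 1"
  shows "(\<integral>\<^sup>+w. ennreal (b ^ card (pool_step n S w)) \<partial>choice_space p)
    \<le> ennreal (b ^ card S * ((1 - p) ^ card S * b + (1 - (1 - p) ^ card S) / b))"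
proof -
  interpret R: prob_space "choice_space p" by (rule prob_space_choice)
  let ?N = "{w. {i \<in> S. fst w (i, n)} = {}}"
  let ?q = "(1 - p) ^ card S"
  have q: "0 \<le> ?q" "?q \<le> 1" using p by (auto intro: power_le_one)
  note N = emeasure_no_compatible[OF p S, of n]
  have N': "emeasure (choice_space p) (- ?N) = ennreal (1 - ?q)"
    using R.prob_compl[OF N(2)] N(1) q
    by (simp add: space_choice_space Compl_eq_Diff_UNIV R.emeasure_eq_measure)
  have cN: "- ?N \<in> sets (choice_space p)"
    using sets.compl_sets[OF N(2)] by (simp add: space_choice_space Compl_eq_Diff_UNIV)
  have "AE w in choice_space p. ennreal (b ^ card (pool_step n S w))
      \<le> ennreal (b ^ card S * b) * indicator ?N w + ennreal (b ^ card S / b) * indicator (- ?N) w"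
    using AE_choice_space_unit[where p = p and n = n]
  proof eventually_elim
    case (elim w)
    let ?K = "{i \<in> S. fst w (i, n)}"
    show ?case
    proof (cases "?K = {}")
      case True
      have "card (insert n S) \<le> Suc (card S)" by (rule card_insert_le_m1) auto
      then have "b ^ card (insert n S) \<le> b ^ Suc (card S)" using b by (rule power_increasing)
      then show ?thesis using True by (simp add: pool_step_def mult.commute ennreal_leI)
    next
      case False
      then have "uniform_choice (snd w n) ?K \<in> S"
        using uniform_choice_in[of ?K "snd w n"] S elim by auto
      moreover have "pool_step n S w = S - {uniform_choice (snd w n) ?K}"
        unfolding pool_step_def Let_def using False by (rule if_not_P)
      ultimately have "card S = Suc (card (pool_step n S w))"
        using S by (simp only: card_Suc_Diff1)
      then have "b ^ card (pool_step n S w) = b ^ card S / b" using b by simp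
      then show ?thesis using False by simp
    qed
  qed
  then have "(\<integral>\<^sup>+w. ennreal (b ^ card (pool_step n S w)) \<partial>choice_space p)
      \<le> (\<integral>\<^sup>+w. ennreal (b ^ card S * b) * indicator ?N w + ennreal (b ^ card S / b) * indicator (- ?N) w \<partial>choice_space p)"
    by (rule nn_integral_mono_AE)
  also have "\<dots> = ennreal (b ^ card S * b) * ennreal ?q + ennreal (b ^ card S / b) * ennreal (1 - ?q)"
    using N N' cN by (subst nn_integral_add) (auto simp: nn_integral_cmult)
  also have "\<dots> = ennreal (b ^ card S * b * ?q + b ^ card S / b * (1 - ?q))"
    using b q by (subst (1 2) ennreal_mult[symmetric]) (auto simp del: ennreal_plus simp flip: ennreal_plus)
  also have "b ^ card S * b * ?q + b ^ card S / b * (1 - ?q) = b ^ card S * (?q * b + (1 - ?q) / b)"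
    by (simp add: algebra_simps add_divide_distrib diff_divide_distrib)
  finally show ?thesis .
qed

lemma nn_integral_pool_step_member:
  fixes p :: real
  assumes p: "0 \<le> p" "p \<le> 1" and S: "finite S" "i \<in> S" "n \<noteq> i"
  shows "(\<integral>\<^sup>+w. indicator {P. i \<in> P} (pool_step n S w) \<partial>choice_space p)
    \<le> ennreal (1 - (1 - (1 - p) ^ card S) / card S)"
proof -
  interpret R: prob_space "choice_space p" by (rule prob_space_choice)
  obtain D where D: "D \<in> sets (choice_space p)"
    "D \<subseteq> {w. i \<in> {j \<in> S. fst w (j, n)} \<and> uniform_choice (snd w n) {j \<in> S. fst w (j, n)} = i}"
    "measure (choice_space p) D \<ge> (1 - (1 - p) ^ card S) / card S"
    using chosen_event[OF p S(1,2)] by blast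
  have "(\<integral>\<^sup>+w. indicator {P. i \<in> P} (pool_step n S w) \<partial>choice_space p)
      \<le> (\<integral>\<^sup>+w. indicator (space (choice_space p) - D) w \<partial>choice_space p)"
  proof (rule nn_integral_mono)
    fix w
    have "i \<notin> pool_step n S w" if "w \<in> D"
      using that D(2) by (auto simp: pool_step_def Let_def)
    then show "indicator {P. i \<in> P} (pool_step n S w) \<le> (indicator (space (choice_space p) - D) w :: ennreal)"
      by (auto simp: space_choice_space split: split_indicator)
  qed
  also have "\<dots> = ennreal (1 - R.prob D)"
    using D(1) by (simp add: R.emeasure_eq_measure R.prob_compl)
  also have "\<dots> \<le> ennreal (1 - (1 - (1 - p) ^ card S) / card S)"
    using D(3) by (intro ennreal_leI) simp
  finally show ?thesis .
qed

lemma not_in_pool_step: "i \<notin> S \<Longrightarrow> i \<noteq> n \<Longrightarrow> i \<notin> pool_step n S w"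
  by (auto simp: pool_step_def Let_def)

section \<open>Concentration of the pool size and survival in the pool\<close>

lemma finite_present: "finite P \<Longrightarrow> finite (present E X t P)"
  by (rule finite_subset[OF present_subset])

lemma card_present_le: "finite P \<Longrightarrow> card (present E X t P) \<le> card P"
  by (rule card_mono[OF _ present_subset])

lemma measurable_fun_pool [measurable]:
  fixes f :: "nat set \<Rightarrow> ennreal"
  shows "(\<lambda>w. f (pool E X w n)) \<in> borel_measurable (choice_space p)"
  by (rule measurable_compose[OF measurable_pool_choice]) simp

text \<open>
  Exponential Lyapunov function: above size \<open>z\<^sub>1\<close> the pool grows with probability at most \<open>q < 1/2\<close>, so
  \<open>b\<close> to the pool size contracts by the factor \<open>\<rho>\<close>. Departures only decrease it.
\<close>

lemma nn_integral_pool_power_le: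
  fixes p b q \<rho> z\<^sub>1 :: real
  assumes p: "0 \<le> p" "p \<le> 1" and b: "b > 1" and z1: "z\<^sub>1 \<ge> 0"
    and q: "\<And>z::nat. z\<^sub>1 \<le> real z \<Longrightarrow> (1 - p) ^ z \<le> q"
    and \<rho>: "q * b + (1 - q) / b \<le> \<rho>" "0 \<le> \<rho>" "\<rho> < 1"
  shows "(\<integral>\<^sup>+w. ennreal (b ^ card (pool E X w n)) \<partial>choice_space p) \<le> ennreal (b powr (z\<^sub>1 + 1) / (1 - \<rho>))"
proof (induction n)
  case 0
  interpret R: prob_space "choice_space p" by (rule prob_space_choice)
  have "1 \<le> b powr (z\<^sub>1 + 1)" using b z1 by (intro ge_one_powr_ge_zero) auto
  then have "1 \<le> b powr (z\<^sub>1 + 1) / (1 - \<rho>)" using \<rho> by (simp add: field_simps)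
  then have "ennreal 1 \<le> ennreal (b powr (z\<^sub>1 + 1) / (1 - \<rho>))" by (rule ennreal_leI)
  then show ?case by (simp add: R.emeasure_space_1)
next
  case (Suc n)
  let ?B = "b powr (z\<^sub>1 + 1)"
  have step: "(\<integral>\<^sup>+w'. ennreal (b ^ card (pool_step n (present E X (arrival_time E n) (pool E X w n)) w')) \<partial>choice_space p)
      \<le> ennreal \<rho> * ennreal (b ^ card (pool E X w n)) + ennreal ?B" for w
  proof -
    let ?S = "present E X (arrival_time E n) (pool E X w n)"
    let ?q = "(1 - p) ^ card ?S"
    have S: "finite ?S" by (intro finite_present finite_pool)
    have bS: "b ^ card ?S \<le> b ^ card (pool E X w n)"
      using b by (intro power_increasing card_present_le finite_pool) auto
    have q0: "0 \<le> ?q" "?q \<le> 1" using p by (auto intro: power_le_one)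
    \<comment> \<open>The expected factor increases with the joining probability because
      \<open>b\<close> exceeds \<open>1 / b\<close>; this allows replacing the true probability by
      its bound \<open>q\<close>, or by 1.\<close>
    have mono: "x * b + (1 - x) / b \<le> y * b + (1 - y) / b" if "x \<le> y" for x y
    proof -
      have "1 / b \<le> 1" using b by simp
      then have "x * (b - 1 / b) \<le> y * (b - 1 / b)" using that b by (intro mult_right_mono) linarith+
      then show ?thesis by (simp add: algebra_simps diff_divide_distrib)
    qed
    have "b ^ card ?S * (?q * b + (1 - ?q) / b) \<le> \<rho> * b ^ card (pool E X w n) + ?B"
    proof (cases "z\<^sub>1 \<le> card ?S")
      case True
      have "?q * b + (1 - ?q) / b \<le> \<rho>" using mono[OF q[OF True]] \<rho> by linarith
      then have "b ^ card ?S * (?q * b + (1 - ?q) / b) \<le> b ^ card (pool E X w n) * \<rho>"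
        using b bS q0 by (intro mult_mono) auto
      then show ?thesis by (simp add: mult.commute add_increasing2)
    \<comment> \<open>Below \<open>z\<^sub>1\<close> there is no contraction, but one step reaches
      at most size \<open>z\<^sub>1 + 1\<close>; this produces the additive constant.\<close>
    next
      case False
      have "?q * b + (1 - ?q) / b \<le> b" using mono[OF q0(2)] by simp
      then have "b ^ card ?S * (?q * b + (1 - ?q) / b) \<le> b ^ card ?S * b"
        using b by (intro mult_left_mono) auto
      also have "\<dots> = b powr (card ?S + 1)"
        using b by (simp add: powr_add powr_realpow)
      also have "\<dots> \<le> ?B" using False b by (intro powr_mono) auto
      finally show ?thesis using b \<rho>(2) by (simp add: add_increasing)
    qed
    then have "ennreal (b ^ card ?S * (?q * b + (1 - ?q) / b)) \<le> ennreal (\<rho> * b ^ card (pool E X w n) + ?B)"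
      by (rule ennreal_leI)
    also have "\<dots> = ennreal \<rho> * ennreal (b ^ card (pool E X w n)) + ennreal ?B"
      using b \<rho> by (simp add: ennreal_plus ennreal_mult)
    finally show ?thesis
      using nn_integral_pool_step_power[OF p S, of b n] b by (meson less_imp_le order_trans)
  qed
  interpret R: prob_space "choice_space p" by (rule prob_space_choice)
  have "(\<integral>\<^sup>+w. ennreal (b ^ card (pool E X w (Suc n))) \<partial>choice_space p)
      \<le> (\<integral>\<^sup>+w. ennreal \<rho> * ennreal (b ^ card (pool E X w n)) + ennreal ?B \<partial>choice_space p)"
    unfolding nn_integral_pool_Suc[where f = "\<lambda>P. ennreal (b ^ card P)"] by (intro nn_integral_mono step)
  also have "\<dots> = ennreal \<rho> * (\<integral>\<^sup>+w. ennreal (b ^ card (pool E X w n)) \<partial>choice_space p) + ennreal ?B"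
    by (subst nn_integral_add)
       (auto simp: nn_integral_cmult R.emeasure_space_1 measurable_fun_pool[where f = "\<lambda>P. ennreal (b ^ card P)"])
  also have "\<dots> \<le> ennreal \<rho> * ennreal (?B / (1 - \<rho>)) + ennreal ?B"
    by (intro add_mono mult_left_mono Suc) auto
  also have "\<dots> = ennreal (\<rho> * (?B / (1 - \<rho>)) + ?B)"
    using \<rho> ennreal_mult[of \<rho> "?B / (1 - \<rho>)"] by (simp add: ennreal_plus)
  \<comment> \<open>The claimed bound is the fixed point of the recursion
    \<open>x = \<rho> * x + ?B\<close>, so the induction reproduces it.\<close>
  also have "\<rho> * (?B / (1 - \<rho>)) + ?B = ?B / (1 - \<rho>)"
    using \<rho> by (simp add: field_simps)
  finally show ?case .
qed

text \<open>Markov's inequality for the exponential of the pool size. The gap between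
  \<open>z\<^sub>1\<close> and \<open>z\<^sub>2\<close> turns into exponential decay.\<close>

lemma nn_integral_pool_large_le:
  fixes p b q \<rho> z\<^sub>1 z\<^sub>2 :: real
  assumes p: "0 \<le> p" "p \<le> 1" and b: "b > 1" and z1: "z\<^sub>1 \<ge> 0"
    and q: "\<And>z::nat. z\<^sub>1 \<le> real z \<Longrightarrow> (1 - p) ^ z \<le> q"
    and \<rho>: "q * b + (1 - q) / b \<le> \<rho>" "0 \<le> \<rho>" "\<rho> < 1"
  shows "(\<integral>\<^sup>+w. indicator {P. card P > z\<^sub>2} (pool E X w n) \<partial>choice_space p)
    \<le> ennreal (b powr (z\<^sub>1 + 1 - z\<^sub>2) / (1 - \<rho>))"
proof -
  have "(\<integral>\<^sup>+w. indicator {P. card P > z\<^sub>2} (pool E X w n) \<partial>choice_space p)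
      \<le> (\<integral>\<^sup>+w. ennreal (b powr - z\<^sub>2) * ennreal (b ^ card (pool E X w n)) \<partial>choice_space p)"
  proof (rule nn_integral_mono)
    fix w
    have "1 \<le> b powr - z\<^sub>2 * b ^ card (pool E X w n)" if "card (pool E X w n) > z\<^sub>2"
    proof -
      have "1 \<le> b powr (- z\<^sub>2 + card (pool E X w n))"
        using that b by (intro ge_one_powr_ge_zero) auto
      moreover have "b > 0" using b by simp
      ultimately show ?thesis by (simp only: powr_add powr_realpow)
    qed
    then show "indicator {P. card P > z\<^sub>2} (pool E X w n)
        \<le> ennreal (b powr - z\<^sub>2) * ennreal (b ^ card (pool E X w n))"
      using b by (auto split: split_indicator simp flip: ennreal_mult ennreal_1 intro!: ennreal_leI)
  qed
  also have "\<dots> = ennreal (b powr - z\<^sub>2) * (\<integral>\<^sup>+w. ennreal (b ^ card (pool E X w n)) \<partial>choice_space p)"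
    by (intro nn_integral_cmult measurable_fun_pool[where f = "\<lambda>P. ennreal (b ^ card P)"])
  also have "\<dots> \<le> ennreal (b powr - z\<^sub>2) * ennreal (b powr (z\<^sub>1 + 1) / (1 - \<rho>))"
    by (intro mult_left_mono nn_integral_pool_power_le[OF assms]) auto
  also have "\<dots> = ennreal (b powr (z\<^sub>1 + 1 - z\<^sub>2) / (1 - \<rho>))"
    using \<rho> by (simp add: powr_add powr_diff powr_minus field_simps flip: ennreal_mult)
  finally show ?thesis .
qed

text \<open>When the pool exceeds \<open>z\<^sub>2\<close>, survival is bounded by 1. Otherwise
  departures only make it smaller, so if \<open>i\<close> is still present she is chosen with
  probability at least \<open>r\<close>; an agent who is gone never returns.\<close>

lemma nn_integral_pool_member_Suc_le:
  fixes p r z\<^sub>2 :: real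
  assumes p: "0 \<le> p" "p \<le> 1" and i: "n \<noteq> i"
    and r: "\<And>z::nat. 0 < z \<Longrightarrow> real z \<le> z\<^sub>2 \<Longrightarrow> r \<le> (1 - (1 - p) ^ z) / z"
  shows "(\<integral>\<^sup>+w. indicator {P. i \<in> P} (pool E X w (Suc n)) \<partial>choice_space p)
    \<le> ennreal (1 - r) * (\<integral>\<^sup>+w. indicator {P. i \<in> P} (pool E X w n) \<partial>choice_space p)
      + (\<integral>\<^sup>+w. indicator {P. card P > z\<^sub>2} (pool E X w n) \<partial>choice_space p)"
proof -
  interpret R: prob_space "choice_space p" by (rule prob_space_choice)
  have step: "(\<integral>\<^sup>+w'. indicator {P. i \<in> P} (pool_step n (present E X (arrival_time E n) (pool E X w n)) w') \<partial>choice_space p)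
      \<le> ennreal (1 - r) * indicator {P. i \<in> P} (pool E X w n) + indicator {P. card P > z\<^sub>2} (pool E X w n)"
    (is "?L \<le> ?R") for w
  proof -
    let ?S = "present E X (arrival_time E n) (pool E X w n)"
    have S: "finite ?S" by (intro finite_present finite_pool)
    show ?thesis
    proof (cases "i \<in> ?S")
      case False
      have "?L = 0" using not_in_pool_step[OF False] i by simp
      then show ?thesis by simp
    next
      case True
      then have i': "i \<in> pool E X w n" using present_subset by blast
      show ?thesis
      proof (cases "card (pool E X w n) > z\<^sub>2")
        case True
        have "?L \<le> (\<integral>\<^sup>+w'. 1 \<partial>choice_space p)"
          by (intro nn_integral_mono) (auto split: split_indicator)
        also have "\<dots> = 1" by (simp add: R.emeasure_space_1)
        finally show ?thesis using True by (simp add: add_increasing)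
      next
        case False
        have "0 < card ?S" using True S card_gt_0_iff by blast
        moreover have "card ?S \<le> z\<^sub>2"
          using False card_present_le[OF finite_pool, of E X "arrival_time E n" E X w n] by linarith
        ultimately have "r \<le> (1 - (1 - p) ^ card ?S) / card ?S" by (rule r)
        then have "ennreal (1 - (1 - (1 - p) ^ card ?S) / card ?S) \<le> ennreal (1 - r)"
          by (intro ennreal_leI) simp
        then have "?L \<le> ennreal (1 - r)"
          using nn_integral_pool_step_member[OF p S True i] by (rule order_trans[rotated])
        then show ?thesis using i' by (simp add: add_increasing2)
      qed
    qed
  qed
  have "(\<integral>\<^sup>+w. indicator {P. i \<in> P} (pool E X w (Suc n)) \<partial>choice_space p)
      \<le> (\<integral>\<^sup>+w. ennreal (1 - r) * indicator {P. i \<in> P} (pool E X w n)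
           + indicator {P. card P > z\<^sub>2} (pool E X w n) \<partial>choice_space p)"
    unfolding nn_integral_pool_Suc by (intro nn_integral_mono step)
  then show ?thesis
    by (subst (asm) nn_integral_add) (simp_all add: nn_integral_cmult)
qed

text \<open>Iterates the one-step bound from the moment just after the arrival of \<open>i\<close>
  herself, hence the index \<open>Suc i + k\<close> after \<open>k\<close> further arrivals. Each
  step adds at most the probability of an oversized pool, since earlier such terms are only
  multiplied by \<open>1 - r\<close>, which is at most 1.\<close>

lemma nn_integral_pool_member_le:
  fixes p b q \<rho> r z\<^sub>1 z\<^sub>2 :: real
  assumes p: "0 \<le> p" "p \<le> 1" and b: "b > 1" and z1: "z\<^sub>1 \<ge> 0"
    and q: "\<And>z::nat. z\<^sub>1 \<le> real z \<Longrightarrow> (1 - p) ^ z \<le> q"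
    and \<rho>: "q * b + (1 - q) / b \<le> \<rho>" "0 \<le> \<rho>" "\<rho> < 1"
    and r: "\<And>z::nat. 0 < z \<Longrightarrow> real z \<le> z\<^sub>2 \<Longrightarrow> r \<le> (1 - (1 - p) ^ z) / z" and r01: "0 \<le> r" "r \<le> 1"
  shows "(\<integral>\<^sup>+w. indicator {P. i \<in> P} (pool E X w (Suc i + k)) \<partial>choice_space p)
    \<le> ennreal ((1 - r) ^ k + k * (b powr (z\<^sub>1 + 1 - z\<^sub>2) / (1 - \<rho>)))"
proof (induction k)
  case 0
  interpret R: prob_space "choice_space p" by (rule prob_space_choice)
  have "(\<integral>\<^sup>+w. indicator {P. i \<in> P} (pool E X w (Suc i + 0)) \<partial>choice_space p) \<le> (\<integral>\<^sup>+w'. 1 \<partial>choice_space p)"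
    by (intro nn_integral_mono) (auto split: split_indicator)
  then show ?case by (simp add: R.emeasure_space_1)
next
  case (Suc k)
  let ?\<beta> = "b powr (z\<^sub>1 + 1 - z\<^sub>2) / (1 - \<rho>)"
  have \<beta>: "0 \<le> ?\<beta>" using \<rho> by simp
  have eq: "ennreal (1 - r) * ennreal x + ennreal y = ennreal ((1 - r) * x + y)" if "0 \<le> x" "0 \<le> y" for x y
    using r01 that by (simp add: ennreal_plus ennreal_mult)
  have "(\<integral>\<^sup>+w. indicator {P. i \<in> P} (pool E X w (Suc (Suc i + k))) \<partial>choice_space p)
    \<le> ennreal (1 - r) * (\<integral>\<^sup>+w. indicator {P. i \<in> P} (pool E X w (Suc i + k)) \<partial>choice_space p)
      + (\<integral>\<^sup>+w. indicator {P. card P > z\<^sub>2} (pool E X w (Suc i + k)) \<partial>choice_space p)"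
    by (rule nn_integral_pool_member_Suc_le[OF p _ r]) auto
  also have "\<dots> \<le> ennreal (1 - r) * ennreal ((1 - r) ^ k + k * ?\<beta>) + ennreal ?\<beta>"
    by (intro add_mono mult_left_mono Suc nn_integral_pool_large_le[OF p b z1 q \<rho>]) auto
  also have "\<dots> = ennreal ((1 - r) * ((1 - r) ^ k + k * ?\<beta>) + ?\<beta>)"
    by (rule eq[OF add_nonneg_nonneg[OF zero_le_power mult_nonneg_nonneg[OF of_nat_0_le_iff \<beta>]] \<beta>])
       (use r01 in simp)
  also have "\<dots> \<le> ennreal ((1 - r) ^ Suc k + Suc k * ?\<beta>)"
  proof (rule ennreal_leI)
    have "(1 - r) * (k * ?\<beta>) \<le> 1 * (k * ?\<beta>)"
      using r01 mult_nonneg_nonneg[OF of_nat_0_le_iff[of k] \<beta>] by (intro mult_right_mono) simp_all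
    then show "(1 - r) * ((1 - r) ^ k + k * ?\<beta>) + ?\<beta> \<le> (1 - r) ^ Suc k + Suc k * ?\<beta>"
      by (simp only: distrib_left power_Suc of_nat_Suc distrib_right mult_1_left)
  qed
  finally show ?case by simp
qed

section \<open>Perished agents stay in the pool for a unit of time\<close>

lemma snd_greedy_state_mono: "n \<le> n' \<Longrightarrow> snd (greedy_state \<omega> n) \<subseteq> snd (greedy_state \<omega> n')"
  by (rule lift_Suc_mono_le[of "\<lambda>n. snd (greedy_state \<omega> n)"]) (auto simp: Let_def case_prod_beta)

lemma finite_greedy_matched: "finite (snd (greedy_state \<omega> n))"
  by (induction n) (auto simp: Let_def case_prod_beta)

text \<open>A pool member leaves only by being matched or by being found expired at a later arrival,
  and both are excluded. On her own arrival, not joining the pool would mean being matched.\<close>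

lemma unmatched_in_pool:
  assumes "i < N" "i \<notin> snd (greedy_state (E, X, w) N)"
    and "\<And>n. n < N \<Longrightarrow> ennreal (arrival_time E n) < ennreal (arrival_time E i) + X i"
  shows "i \<in> pool E X w N"
  using assms
proof (induction N)
  case (Suc N)
  obtain C U where w: "w = (C, U)" by (cases w)
  obtain P G where PG: "greedy_state (E, X, C, U) N = (P, G)" by fastforce
  have P: "pool E X w N = P" using PG fst_greedy_state[of E X w N] by (simp add: w)
  define S where "S = present E X (arrival_time E N) P"
  define K where "K = {i \<in> S. C (i, N)}"
  have G: "snd (greedy_state (E, X, w) (Suc N)) = (if K = {} then G else G \<union> {uniform_choice (U N) K, N})"
    by (auto simp: w PG S_def K_def Let_def)
  have pool: "pool E X w (Suc N) = (if K = {} then insert N S else S - {uniform_choice (U N) K})"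
    unfolding pool.simps Let_def P by (simp only: w fst_conv snd_conv S_def K_def)
  show ?case
  proof (cases "i = N")
    case True
    then show ?thesis using Suc.prems(2) unfolding G pool by (auto split: if_splits)
  next
    case False
    then have "i < N" using Suc.prems by simp
    moreover have "i \<notin> snd (greedy_state (E, X, w) N)"
      using Suc.prems(2) unfolding G by (auto simp: w PG split: if_splits)
    ultimately have "i \<in> P" using Suc.IH Suc.prems(3) P by auto
    then have "i \<in> S" using Suc.prems(3)[of N] by (simp add: S_def present_def)
    then show ?thesis using Suc.prems(2) unfolding G pool by (auto split: if_splits)
  qed
qed simp

lemma arrival_time_mono:
  assumes "\<And>n. E n \<ge> 0" "n \<le> n'"
  shows "arrival_time E n \<le> arrival_time E n'"
  unfolding arrival_time_def using assms by (intro sum_mono2) auto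

text \<open>Arrival times are nondecreasing, so a finite set of arrivals up to \<open>T\<close> is
  an initial segment and its cardinality is its length. This turns counting into comparing
  indices.\<close>

lemma arrivals_set:
  assumes E: "\<And>n. E n \<ge> 0" and fin: "finite {n. arrival_time E n \<le> T}"
  shows "{n. arrival_time E n \<le> T} = {..<arrivals (E, X, w) T}"
proof -
  let ?A = "{n. arrival_time E n \<le> T}"
  have "\<exists>a. ?A = {..<a}"
  proof (cases "?A = {}")
    case False
    have "?A = {..<Suc (Max ?A)}"
    proof
      show "?A \<subseteq> {..<Suc (Max ?A)}" using fin by (auto simp: less_Suc_eq_le)
      have "arrival_time E (Max ?A) \<le> T" using Max_in[OF fin False] by simp
      then show "{..<Suc (Max ?A)} \<subseteq> ?A"
        using arrival_time_mono[of E] E by (fastforce simp: less_Suc_eq_le)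
    qed
    then show ?thesis by blast
  qed auto
  then obtain a where a: "?A = {..<a}" by blast
  then show ?thesis by (cases w) (simp add: arrivals_def)
qed

text \<open>An agent unaccounted for at \<open>T\<close> had her deadline by \<open>T\<close>, and
  it lies at least one unit after her arrival. Hence agent \<open>i + k\<close> arrives before both
  that deadline and \<open>T\<close>, and being unmatched at \<open>T\<close> carries back to that
  moment.\<close>

lemma perished_in_pool:
  assumes E: "\<And>n. E n \<ge> 0" and X: "\<And>n. X n \<ge> 1" and fin: "finite {n. arrival_time E n \<le> T}"
    and i: "i < arrivals (E, X, w) T" "i \<notin> greedy_matched (E, X, w) T" "i \<notin> greedy_pool (E, X, w) T"
    and k: "arrival_time E (i + k) < arrival_time E i + 1"
  shows "i \<in> pool E X w (Suc i + k)"
proof -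
  let ?a = "arrivals (E, X, w) T"
  have a: "n < ?a \<longleftrightarrow> arrival_time E n \<le> T" for n
    using arrivals_set[OF E fin, of X w] by (auto simp: set_eq_iff)
  have pos: "0 \<le> arrival_time E n" for n unfolding arrival_time_def using E by (intro sum_nonneg)
  have A: "ennreal (arrival_time E i) + X i \<le> ennreal T"
  proof (rule ccontr)
    assume "\<not> ?thesis"
    then have T: "ennreal T < ennreal (arrival_time E i) + X i" by simp
    have "i \<in> pool E X w ?a"
    proof (rule unmatched_in_pool[OF i(1)])
      show "i \<notin> snd (greedy_state (E, X, w) ?a)" using i(2) by (simp add: greedy_matched_def)
      show "ennreal (arrival_time E n) < ennreal (arrival_time E i) + X i" if "n < ?a" for n
        using that T ennreal_leI[of "arrival_time E n" T] a by (meson le_less_trans)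
    qed
    then have "i \<in> greedy_pool (E, X, w) T"
      using T fst_greedy_state[of E X w] by (cases w) (simp add: greedy_pool_def present_def)
    then show False using i(3) by simp
  qed
  have one: "ennreal (arrival_time E i + 1) \<le> ennreal (arrival_time E i) + X i"
    using X[of i] pos[of i] by (simp add: ennreal_plus add_left_mono)
  then have "ennreal (arrival_time E i + 1) \<le> ennreal T" using A by (rule order_trans)
  \<comment> \<open>For negative \<open>T\<close> the embedding into \<open>ennreal\<close> gives 0;
    the positive left-hand side rules that out.\<close>
  then have "arrival_time E i + 1 \<le> T" using pos[of i] by (subst (asm) ennreal_le_iff2) auto
  then have ka: "Suc i + k \<le> ?a" using k a[of "i + k"] by simp
  show ?thesis
  proof (rule unmatched_in_pool)
    show "i \<notin> snd (greedy_state (E, X, w) (Suc i + k))"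
      using i(2) snd_greedy_state_mono[OF ka, of "(E, X, w)"] by (auto simp: greedy_matched_def)
    fix n assume "n < Suc i + k"
    then have "arrival_time E n \<le> arrival_time E (i + k)" by (intro arrival_time_mono E) auto
    then have "arrival_time E n < arrival_time E i + 1" using k by simp
    then have "ennreal (arrival_time E n) < ennreal (arrival_time E i + 1)"
      by (simp only: ennreal_less_iff[OF pos])
    then show "ennreal (arrival_time E n) < ennreal (arrival_time E i) + X i"
      using one by (rule less_le_trans)
  qed simp
qed

text \<open>Each perished agent either sees her next \<open>k\<close> interarrival times fill a
  whole unit of time, or is still in the pool after those \<open>k\<close> arrivals. Summing over
  all indices with an indicator replaces the random number of terms.\<close>

lemma perished_count_le:
  assumes E: "\<And>n. E n \<ge> 0" and X: "\<And>n. X n \<ge> 1"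
  shows "ennreal (real (arrivals (E, X, w) T) - real (card (greedy_matched (E, X, w) T))
      - real (card (greedy_pool (E, X, w) T)))
    \<le> (\<Sum>i. indicator {..T} (arrival_time E i) *
        (indicator {1..} (\<Sum>j\<in>{i<..i + k}. E j) + indicator {P. i \<in> P} (pool E X w (Suc i + k))))"
    (is "ennreal ?l \<le> (\<Sum>i. ?f i)")
proof (cases "finite {n. arrival_time E n \<le> T}")
  case False
  \<comment> \<open>the cardinality of an infinite set is 0\<close>
  then have "arrivals (E, X, w) T = 0" by (cases w) (simp add: arrivals_def)
  then have "?l \<le> 0" by simp
  then show ?thesis by (simp add: ennreal_neg)
next
  case True
  let ?a = "arrivals (E, X, w) T"
  let ?Q = "greedy_matched (E, X, w) T \<union> greedy_pool (E, X, w) T"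
  have a: "n < ?a \<longleftrightarrow> arrival_time E n \<le> T" for n
    using arrivals_set[OF E True, of X w] by (auto simp: set_eq_iff)
  \<comment> \<open>Only cardinalities are compared: matched or pooled agents counted twice, or
    lying outside the initial segment, would merely lower \<open>?l\<close>.\<close>
  have "real ?a \<le> real (card ({..<?a} - ?Q)) + real (card ({..<?a} \<inter> ?Q))"
    using card_Diff_subset_Int[of "{..<?a}" ?Q] card_mono[of "{..<?a}" "{..<?a} \<inter> ?Q"] by simp
  moreover have "card ({..<?a} \<inter> ?Q) \<le> card (greedy_matched (E, X, w) T) + card (greedy_pool (E, X, w) T)"
  proof -
    have "finite (greedy_matched (E, X, w) T)" "finite (greedy_pool (E, X, w) T)"
      by (auto simp: greedy_matched_def greedy_pool_def finite_greedy_matched fst_greedy_state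
          finite_present finite_pool split: prod.split)
    then have "card ({..<?a} \<inter> ?Q) \<le> card ?Q" by (intro card_mono) auto
    also have "\<dots> \<le> card (greedy_matched (E, X, w) T) + card (greedy_pool (E, X, w) T)" by (rule card_Un_le)
    finally show ?thesis .
  qed
  ultimately have "?l \<le> real (card ({..<?a} - ?Q))" by linarith
  then have "ennreal ?l \<le> ennreal (real (card ({..<?a} - ?Q)))" by (rule ennreal_leI)
  also have "\<dots> = (\<Sum>i\<in>{..<?a} - ?Q. 1)" by (simp add: ennreal_of_nat_eq_real_of_nat)
  also have "\<dots> \<le> (\<Sum>i\<in>{..<?a} - ?Q. ?f i)"
  proof (rule sum_mono)
    fix i assume i: "i \<in> {..<?a} - ?Q"
    have "arrival_time E (i + k) = arrival_time E i + (\<Sum>j\<in>{i<..i + k}. E j)"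
    proof -
      have "{..i + k} = {..i} \<union> {i<..i + k}" by auto
      then show ?thesis unfolding arrival_time_def by (simp only:) (rule sum.union_disjoint, auto)
    qed
    then have "(\<Sum>j\<in>{i<..i + k}. E j) < 1 \<Longrightarrow> i \<in> pool E X w (Suc i + k)"
      using i perished_in_pool[OF E X True, where i = i and w = w and k = k] by auto
    then show "1 \<le> ?f i" using i a by (auto split: split_indicator simp: not_le)
  qed
  also have "\<dots> \<le> (\<Sum>i. ?f i)"
    by (intro sum_le_suminf) auto
  finally show ?thesis .
qed

section \<open>Poisson arrivals\<close>

abbreviation "interarrival_space m \<equiv>
  \<Pi>\<^sub>M i\<in>(UNIV :: nat set). density lborel (\<lambda>x. ennreal (exponential_density m x))"

lemma prob_space_interarrival: "0 < m \<Longrightarrow> prob_space (interarrival_space m)"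
  by (intro prob_space_PiM prob_space_exponential_density)

text \<open>The restriction of the infinite product to \<open>I\<close> has the product law, so the
  coordinates are independent and the sum of exponentials is Erlang. The shape index of
  \<open>erlang_density\<close> is one less than the number of summands.\<close>

lemma distributed_sum_interarrival:
  assumes m: "0 < m" and I: "finite I" "I \<noteq> {}"
  shows "distributed (interarrival_space m) lborel (\<lambda>E. \<Sum>i\<in>I. E i) (erlang_density (card I - 1) m)"
proof -
  let ?D = "density lborel (\<lambda>x. ennreal (exponential_density m x))"
  interpret product_prob_space "\<lambda>_ :: nat. ?D" UNIV
    by (simp add: product_prob_space_def product_prob_space_axioms_def product_sigma_finite_def
        prob_space_exponential_density[OF m] prob_space_imp_sigma_finite)
  have comp: "distr (interarrival_space m) borel (\<lambda>E. E i) = ?D" for i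
    using PiM_component[of i] distr_cong[of "interarrival_space m" "interarrival_space m" borel ?D "\<lambda>E. E i"] by simp
  have X: "distributed (interarrival_space m) lborel (\<lambda>E. E i) (exponential_density m)" for i
    unfolding distributed_def
    using PiM_component[of i] distr_cong[of "interarrival_space m" "interarrival_space m" lborel ?D "\<lambda>E. E i"] by simp
  have "indep_vars (\<lambda>_. borel) (\<lambda>i E. E i) I"
  proof (subst indep_vars_iff_distr_eq_PiM'[OF I(2)])
    have "distr (interarrival_space m) (Pi\<^sub>M I (\<lambda>_. borel)) (\<lambda>x. \<lambda>i\<in>I. x i)
        = distr (interarrival_space m) (Pi\<^sub>M I (\<lambda>_. ?D)) (\<lambda>x. restrict x I)"
      by (intro distr_cong refl sets_PiM_cong) auto
    also have "\<dots> = Pi\<^sub>M I (\<lambda>_. ?D)" using I by (intro distr_PiM_restrict_finite) auto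
    also have "\<dots> = Pi\<^sub>M I (\<lambda>i. distr (interarrival_space m) borel (\<lambda>E. E i))"
      by (simp add: comp)
    finally show "distr (interarrival_space m) (Pi\<^sub>M I (\<lambda>_. borel)) (\<lambda>x. \<lambda>i\<in>I. x i)
        = Pi\<^sub>M I (\<lambda>i. distr (interarrival_space m) borel (\<lambda>E. E i))" .
  qed auto
  then show ?thesis using X by (intro exponential_distributed_sum I m) auto
qed

text \<open>Up to the factor \<open>l\<close> the terms are Poisson weights with mean
  \<open>l * x\<close>, summed by the exponential series. The sum is the constant arrival
  intensity.\<close>

lemma suminf_erlang_density:
  assumes "0 < l" "0 \<le> x"
  shows "(\<Sum>k. ennreal (erlang_density k l x)) = ennreal l"
proof -
  have "(\<lambda>k. l * exp (- l * x) * (inverse (fact k) * (l * x) ^ k)) sums (l * exp (- l * x) * exp (l * x))"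
    using exp_converges[of "l * x"] by (intro sums_mult) (simp add: scaleR_conv_of_real)
  moreover have "l * exp (- l * x) * exp (l * x) = l"
    by (simp add: mult.assoc flip: exp_add)
  moreover have "erlang_density k l x = l * exp (- l * x) * (inverse (fact k) * (l * x) ^ k)" for k
    using assms by (simp add: erlang_density_def power_mult_distrib field_simps)
  ultimately have "(\<lambda>k. erlang_density k l x) sums l" by (simp only:)
  then show ?thesis
    using assms by (subst suminf_ennreal_eq[of _ l]) auto
qed

text \<open>The sum is the expected number of arrivals. Arrival \<open>i\<close> is a sum of
  \<open>i + 1\<close> interarrival times and has Erlang shape \<open>i\<close>; exchanging sum and
  integral leaves the constant intensity over the window.\<close>

lemma expected_arrivals:
  assumes m: "0 < m" and T: "0 \<le> T"
  shows "(\<Sum>i. \<integral>\<^sup>+E. indicator {..T} (arrival_time E i) \<partial>interarrival_space m) = ennreal (m * T)"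
proof -
  have "(\<integral>\<^sup>+E. indicator {..T} (arrival_time E i) \<partial>interarrival_space m)
      = (\<integral>\<^sup>+x. ennreal (erlang_density i m x) * indicator {..T} x \<partial>lborel)" for i
    using distributed_nn_integral[OF distributed_sum_interarrival[OF m, of "{..i}"], of "indicator {..T}"]
    by (simp add: arrival_time_def)
  then have "(\<Sum>i. \<integral>\<^sup>+E. indicator {..T} (arrival_time E i) \<partial>interarrival_space m)
      = (\<integral>\<^sup>+x. (\<Sum>i. ennreal (erlang_density i m x) * indicator {..T} x) \<partial>lborel)"
    by (subst nn_integral_suminf) simp_all
  also have "\<dots> = (\<integral>\<^sup>+x. ennreal m * indicator {0..T} x \<partial>lborel)"
  proof (rule nn_integral_cong)
    fix x
    show "(\<Sum>i. ennreal (erlang_density i m x) * indicator {..T} x) = ennreal m * indicator {0..T} x"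
      using suminf_erlang_density[OF m, of x]
      by (cases "0 \<le> x") (auto simp: erlang_density_def split: split_indicator)
  qed
  also have "\<dots> = ennreal (m * T)"
    using m T by (simp add: nn_integral_cmult ennreal_mult)
  finally show ?thesis .
qed

text \<open>The sum has mean \<open>k / m\<close>, at most \<open>1 - e\<close>, and variance
  \<open>k / m\<^sup>2\<close>, at most \<open>1 / m\<close>. Reaching 1 is therefore a deviation of
  at least \<open>e\<close>, to which Chebyshev applies.\<close>

lemma prob_long_gap_le:
  assumes m: "0 < m" and e: "0 < e" and k: "real k \<le> (1 - e) * m"
  shows "(\<integral>\<^sup>+E. indicator {1..} (\<Sum>j\<in>{i<..i + k}. E j) \<partial>interarrival_space m) \<le> ennreal (1 / (m * e\<^sup>2))"
proof (cases "k = 0")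
  case True
  then show ?thesis by simp
next
  case False
  interpret prob_space "interarrival_space m" by (rule prob_space_interarrival[OF m])
  let ?S = "\<lambda>E. \<Sum>j\<in>{i<..i + k}. E j"
  have D: "distributed (interarrival_space m) lborel ?S (erlang_density (k - 1) m)"
    using distributed_sum_interarrival[OF m, of "{i<..i + k}"] False by simp
  have [measurable]: "?S \<in> borel_measurable (interarrival_space m)"
    using distributed_measurable[OF D] by simp
  have int: "integrable (interarrival_space m) (\<lambda>E. (?S E)\<^sup>2)"
    by (rule erlang_ith_moment_integrable[OF m D])
  have ex: "expectation ?S = k / m"
  proof -
    have "(fact k :: real) = real k * fact (k - 1)" using False by (intro fact_reduce) simp
    then show ?thesis using erlang_ith_moment[OF m D, of 1] False by simp
  qed
  have "k / m \<le> 1 - e" using k m by (simp add: field_simps)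
  then have "prob {E \<in> space (interarrival_space m). 1 \<le> ?S E}
      \<le> prob {E \<in> space (interarrival_space m). e \<le> \<bar>?S E - expectation ?S\<bar>}"
    by (intro finite_measure_mono) (auto simp: ex)
  also have "\<dots> \<le> variance ?S / e\<^sup>2"
    by (rule Chebyshev_inequality[OF _ int e]) simp
  also have "variance ?S = k / m\<^sup>2"
    using erlang_distributed_variance[OF m D] False by (simp add: of_nat_diff)
  also have "k / m\<^sup>2 / e\<^sup>2 \<le> 1 / (m * e\<^sup>2)"
  proof -
    have "(1 - e) * m \<le> 1 * m" using m e by (intro mult_right_mono) auto
    then have "real k \<le> m" using k by simp
    then show ?thesis using m e by (simp add: field_simps power2_eq_square)
  qed
  finally have *: "prob {E \<in> space (interarrival_space m). 1 \<le> ?S E} \<le> 1 / (m * e\<^sup>2)" .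
  have "(\<integral>\<^sup>+E. indicator {1..} (?S E) \<partial>interarrival_space m)
      = (\<integral>\<^sup>+E. indicator {E \<in> space (interarrival_space m). 1 \<le> ?S E} E \<partial>interarrival_space m)"
    by (intro nn_integral_cong) (auto split: split_indicator)
  also have "\<dots> = ennreal (prob {E \<in> space (interarrival_space m). 1 \<le> ?S E})"
    by (simp add: emeasure_eq_measure)
  finally show ?thesis using * by (simp add: ennreal_leI)
qed

text \<open>The arrival time of \<open>i\<close> involves only indices up to \<open>i\<close>, the
  gap only later ones. Resampling the later block makes the two factors separate.\<close>

lemma arrival_and_long_gap_le:
  assumes m: "0 < m" and e: "0 < e" and k: "real k \<le> (1 - e) * m"
  shows "(\<integral>\<^sup>+E. indicator {..T} (arrival_time E i) * indicator {1..} (\<Sum>j\<in>{i<..i + k}. E j) \<partial>interarrival_space m)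
    \<le> (\<integral>\<^sup>+E. indicator {..T} (arrival_time E i) \<partial>interarrival_space m) * ennreal (1 / (m * e\<^sup>2))"
proof -
  let ?J = "{i<..i + k}"
  let ?f = "\<lambda>E. indicator {..T} (arrival_time E i) * indicator {1..} (\<Sum>j\<in>?J. E j) :: ennreal"
  let ?r = "\<lambda>E E' j. if j \<in> ?J then E' j else E j :: real"
  have sets: "sets (interarrival_space m) = sets (PiM UNIV (\<lambda>_. borel))"
    by (intro sets_PiM_cong) auto
  have [measurable]: "(\<lambda>E. arrival_time E i) \<in> borel_measurable (interarrival_space m)"
    "(\<lambda>E. \<Sum>j\<in>?J. E j) \<in> borel_measurable (interarrival_space m)"
    unfolding measurable_cong_sets[OF sets refl] by measurable
  have r: "?f (?r E E') = indicator {..T} (arrival_time E i) * indicator {1..} (\<Sum>j\<in>?J. E' j)" for E E'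
    by (simp add: arrival_time_def)
  have "(\<integral>\<^sup>+E. ?f E \<partial>interarrival_space m)
      = (\<integral>\<^sup>+E. \<integral>\<^sup>+E'. ?f (?r E E') \<partial>interarrival_space m \<partial>interarrival_space m)"
    by (rule nn_integral_PiM_resample[OF prob_space_exponential_density[OF m]]) measurable
  also have "\<dots> = (\<integral>\<^sup>+E. indicator {..T} (arrival_time E i)
      * (\<integral>\<^sup>+E'. indicator {1..} (\<Sum>j\<in>?J. E' j) \<partial>interarrival_space m) \<partial>interarrival_space m)"
    unfolding r by (intro nn_integral_cong nn_integral_cmult) measurable
  also have "\<dots> = (\<integral>\<^sup>+E. indicator {..T} (arrival_time E i) \<partial>interarrival_space m)
      * (\<integral>\<^sup>+E'. indicator {1..} (\<Sum>j\<in>?J. E' j) \<partial>interarrival_space m)"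
    by (intro nn_integral_multc) measurable
  also have "\<dots> \<le> (\<integral>\<^sup>+E. indicator {..T} (arrival_time E i) \<partial>interarrival_space m) * ennreal (1 / (m * e\<^sup>2))"
    by (intro mult_left_mono prob_long_gap_le[OF m e k]) auto
  finally show ?thesis .
qed

lemma AE_interarrival_nonneg:
  assumes m: "0 < m"
  shows "AE E in interarrival_space m. \<forall>n. 0 \<le> E n"
proof -
  have "AE x in density lborel (\<lambda>x. ennreal (exponential_density m x)). 0 \<le> x"
    by (subst AE_density) (auto simp: exponential_density_def intro!: AE_I2)
  then show ?thesis
    unfolding AE_all_countable by (intro allI AE_PiM_component prob_space_exponential_density[OF m]) auto
qed

section \<open>The loss\<close>

lemma market_space_eq:
  "market_space d \<mu> m = interarrival_space m \<Otimes>\<^sub>M (\<Pi>\<^sub>M i\<in>UNIV. \<mu>) \<Otimes>\<^sub>M choice_space (d / m)"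
  by (simp add: market_space_def choice_space_def)

lemma sets_market_space:
  assumes "sets \<mu> = sets borel"
  shows "sets (market_space d \<mu> m) = sets sample_space"
  unfolding market_space_eq using assms
  by (intro sets_pair_measure_cong sets_PiM_cong sets_choice_space) auto

lemma AE_market_space:
  assumes \<mu>: "prob_space \<mu>" "sets \<mu> = sets borel" "emeasure \<mu> {0..<1} = 0" and m: "0 < m"
  shows "AE \<omega> in market_space d \<mu> m. (\<forall>n. 0 \<le> fst \<omega> n) \<and> (\<forall>n. 1 \<le> fst (snd \<omega>) n)"
proof -
  interpret E: prob_space "interarrival_space m" by (rule prob_space_interarrival[OF m])
  interpret X: prob_space "\<Pi>\<^sub>M i\<in>(UNIV :: nat set). \<mu>" by (intro prob_space_PiM \<mu>(1))
  interpret R: prob_space "choice_space (d / m)" by (rule prob_space_choice)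
  interpret XR: pair_prob_space "\<Pi>\<^sub>M i\<in>(UNIV :: nat set). \<mu>" "choice_space (d / m)" ..
  interpret EXR: pair_prob_space "interarrival_space m" "(\<Pi>\<^sub>M i\<in>(UNIV :: nat set). \<mu>) \<Otimes>\<^sub>M choice_space (d / m)" ..
  have 1: "AE x in \<mu>. 1 \<le> x"
    by (rule AE_I[of _ _ "{0..<1}"]) (use \<mu> in \<open>auto simp: not_le\<close>)
  have X: "AE X in (\<Pi>\<^sub>M i\<in>(UNIV :: nat set). \<mu>). \<forall>n. 1 \<le> X n"
    unfolding AE_all_countable by (intro allI AE_PiM_component \<mu>(1) 1) auto
  have sX [measurable_cong]: "sets (\<Pi>\<^sub>M i\<in>(UNIV :: nat set). \<mu>) = sets (PiM UNIV (\<lambda>_. borel))"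
    using \<mu>(2) by (intro sets_PiM_cong) auto
  have "{y \<in> space ((\<Pi>\<^sub>M i\<in>(UNIV :: nat set). \<mu>) \<Otimes>\<^sub>M choice_space (d / m)). \<forall>n. 1 \<le> fst y n}
      \<in> sets ((\<Pi>\<^sub>M i\<in>(UNIV :: nat set). \<mu>) \<Otimes>\<^sub>M choice_space (d / m))"
    by measurable
  then have Y: "AE y in (\<Pi>\<^sub>M i\<in>(UNIV :: nat set). \<mu>) \<Otimes>\<^sub>M choice_space (d / m). \<forall>n. 1 \<le> fst y n"
    using X by (intro XR.AE_pair_measure) auto
  have "Measurable.pred sample_space (\<lambda>\<omega>. (\<forall>n. 0 \<le> fst \<omega> n) \<and> (\<forall>n. 1 \<le> fst (snd \<omega>) n))"
    by measurable
  then have "{\<omega> \<in> space (market_space d \<mu> m). (\<forall>n. 0 \<le> fst \<omega> n) \<and> (\<forall>n. 1 \<le> fst (snd \<omega>) n)}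
      \<in> sets (market_space d \<mu> m)"
    unfolding pred_def sets_market_space[OF \<mu>(2)] sets_eq_imp_space_eq[OF sets_market_space[OF \<mu>(2)]] .
  then show ?thesis
    unfolding market_space_eq
  proof (rule EXR.AE_pair_measure)
    show "AE x in interarrival_space m. AE y in (\<Pi>\<^sub>M i\<in>(UNIV :: nat set). \<mu>) \<Otimes>\<^sub>M choice_space (d / m).
        (\<forall>n. 0 \<le> fst (x, y) n) \<and> (\<forall>n. 1 \<le> fst (snd (x, y)) n)"
      using AE_interarrival_nonneg[OF m]
    proof eventually_elim
      case (elim E)
      show ?case using Y by eventually_elim (use elim in auto)
    qed
  qed
qed

text \<open>
  For a non-integrable function the left-hand side is the junk value 0.
\<close>

lemma integral_le_enn2real_nn_integral:
  fixes f :: "'a \<Rightarrow> real"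
  shows "(\<integral>x. f x \<partial>M) \<le> enn2real (\<integral>\<^sup>+x. ennreal (f x) \<partial>M)"
  by (cases "integrable M f") (simp_all add: real_lebesgue_integral_def not_integrable_integral_eq)

text \<open>The pool bound holds for all fixed times, so integrating over the draws first replaces
  survival by the constant \<open>Q\<close>. What remains is the expected number of arrivals
  \<open>m * T\<close> times a constant, and the normalisation cancels it; this makes the bound
  uniform in \<open>T\<close>.\<close>

lemma greedy_loss_at_le:
  assumes \<mu>: "prob_space \<mu>" "sets \<mu> = sets borel" "emeasure \<mu> {0..<1} = 0"
    and m: "0 < m" and T: "0 < T" and e: "0 < e" and k: "real k \<le> (1 - e) * m" and Q: "0 \<le> Q"
    and pool: "\<And>E X i. (\<integral>\<^sup>+w. indicator {P. i \<in> P} (pool E X w (Suc i + k)) \<partial>choice_space (d / m)) \<le> ennreal Q"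
  shows "greedy_loss_at d \<mu> m T \<le> Q + 1 / (m * e\<^sup>2)"
proof -
  let ?M = "market_space d \<mu> m"
  let ?E = "interarrival_space m"
  let ?X = "\<Pi>\<^sub>M i\<in>(UNIV :: nat set). \<mu>"
  let ?R = "choice_space (d / m)"
  interpret E: prob_space ?E by (rule prob_space_interarrival[OF m])
  interpret X: prob_space ?X by (intro prob_space_PiM \<mu>(1))
  interpret R: prob_space ?R by (rule prob_space_choice)
  interpret XR: pair_prob_space ?X ?R ..
  define \<delta> where "\<delta> = 1 / (m * e\<^sup>2)"
  have \<delta>: "0 \<le> \<delta>" using m by (simp add: \<delta>_def)
  let ?f = "\<lambda>\<omega>. real (arrivals \<omega> T) - real (card (greedy_matched \<omega> T)) - real (card (greedy_pool \<omega> T))"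
  define a where "a E i = (indicator {..T} (arrival_time E i) :: ennreal)" for E i
  define h where "h E i = (indicator {1..} (\<Sum>j\<in>{i<..i + k}. E j) :: ennreal)" for E :: "nat \<Rightarrow> real" and i
  define s where "s E Y i = (indicator {P. i \<in> P} (pool E (fst Y) (snd Y) (Suc i + k)) :: ennreal)" for E Y i
  let ?g = "\<lambda>\<omega> i. a (fst \<omega>) i * (h (fst \<omega>) i + s (fst \<omega>) (snd \<omega>) i)"
  have sE: "sets ?E = sets (PiM UNIV (\<lambda>_. borel))" by (intro sets_PiM_cong) auto
  have sM: "sets (?E \<Otimes>\<^sub>M ?X \<Otimes>\<^sub>M ?R) = sets sample_space"
    using sets_market_space[OF \<mu>(2), of d m] unfolding market_space_eq .
  have a' [measurable]: "(\<lambda>E. a E i) \<in> borel_measurable ?E" for i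
    unfolding measurable_cong_sets[OF sE refl] a_def by measurable
  have h' [measurable]: "(\<lambda>E. h E i) \<in> borel_measurable ?E" for i
    unfolding measurable_cong_sets[OF sE refl] h_def by measurable
  have s' [measurable]: "(\<lambda>\<omega>. s (fst \<omega>) (snd \<omega>) i) \<in> borel_measurable (?E \<Otimes>\<^sub>M ?X \<Otimes>\<^sub>M ?R)" for i
    using measurable_compose[OF measurable_pool[of "Suc i + k"], of "indicator {P. i \<in> P} :: _ \<Rightarrow> ennreal" borel]
    unfolding measurable_cong_sets[OF sM refl] s_def by (simp add: case_prod_beta')
  have sY [measurable]: "(\<lambda>Y. s E Y i) \<in> borel_measurable (?X \<Otimes>\<^sub>M ?R)" for E i
    using measurable_compose[OF measurable_Pair1' s', of E i] by (simp add: space_PiM)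
  have g: "(\<integral>\<^sup>+\<omega>. ?g \<omega> i \<partial>?M) \<le> (\<integral>\<^sup>+E. a E i \<partial>?E) * ennreal (\<delta> + Q)" for i
  proof -
    have s_le: "(\<integral>\<^sup>+Y. s E Y i \<partial>(?X \<Otimes>\<^sub>M ?R)) \<le> ennreal Q" for E
    proof -
      have "(\<integral>\<^sup>+Y. s E Y i \<partial>(?X \<Otimes>\<^sub>M ?R)) = (\<integral>\<^sup>+X. \<integral>\<^sup>+w. s E (X, w) i \<partial>?R \<partial>?X)"
        by (rule R.nn_integral_fst[symmetric]) measurable
      also have "\<dots> \<le> (\<integral>\<^sup>+X. ennreal Q \<partial>?X)"
        unfolding s_def by (intro nn_integral_mono) (use pool in auto)
      also have "\<dots> = ennreal Q" by (simp add: X.emeasure_space_1)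
      finally show ?thesis .
    qed
    have "(\<integral>\<^sup>+\<omega>. ?g \<omega> i \<partial>?M) = (\<integral>\<^sup>+E. \<integral>\<^sup>+Y. a E i * (h E i + s E Y i) \<partial>(?X \<Otimes>\<^sub>M ?R) \<partial>?E)"
      unfolding market_space_eq by (subst XR.nn_integral_fst[symmetric]) simp_all
    also have "\<dots> \<le> (\<integral>\<^sup>+E. a E i * h E i + a E i * ennreal Q \<partial>?E)"
    proof (rule nn_integral_mono)
      fix E
      have "(\<integral>\<^sup>+Y. a E i * (h E i + s E Y i) \<partial>(?X \<Otimes>\<^sub>M ?R))
          = a E i * (h E i + (\<integral>\<^sup>+Y. s E Y i \<partial>(?X \<Otimes>\<^sub>M ?R)))"
        by (simp add: nn_integral_cmult nn_integral_add XR.emeasure_space_1)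
      also have "\<dots> \<le> a E i * (h E i + ennreal Q)"
        by (intro mult_left_mono add_left_mono s_le) auto
      finally show "(\<integral>\<^sup>+Y. a E i * (h E i + s E Y i) \<partial>(?X \<Otimes>\<^sub>M ?R)) \<le> a E i * h E i + a E i * ennreal Q"
        by (simp add: distrib_left)
    qed
    also have "\<dots> = (\<integral>\<^sup>+E. a E i * h E i \<partial>?E) + (\<integral>\<^sup>+E. a E i \<partial>?E) * ennreal Q"
      by (simp add: nn_integral_add nn_integral_multc)
    also have "\<dots> \<le> (\<integral>\<^sup>+E. a E i \<partial>?E) * ennreal \<delta> + (\<integral>\<^sup>+E. a E i \<partial>?E) * ennreal Q"
      unfolding a_def h_def \<delta>_def by (intro add_right_mono arrival_and_long_gap_le[OF m e k])
    also have "\<dots> = (\<integral>\<^sup>+E. a E i \<partial>?E) * ennreal (\<delta> + Q)"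
      using \<delta> Q by (simp add: ennreal_plus distrib_left)
    finally show ?thesis .
  qed
  have "AE \<omega> in ?M. ennreal (?f \<omega>) \<le> (\<Sum>i. ?g \<omega> i)"
    using AE_market_space[OF \<mu> m, of d]
  proof eventually_elim
    case (elim \<omega>)
    obtain E X w where \<omega>: "\<omega> = (E, X, w)" by (cases \<omega>) auto
    show ?case
      using perished_count_le[of E X w T k] elim by (simp add: \<omega> a_def h_def s_def)
  qed
  then have "(\<integral>\<^sup>+\<omega>. ennreal (?f \<omega>) \<partial>?M) \<le> (\<integral>\<^sup>+\<omega>. (\<Sum>i. ?g \<omega> i) \<partial>?M)"
    by (rule nn_integral_mono_AE)
  also have "\<dots> = (\<Sum>i. \<integral>\<^sup>+\<omega>. ?g \<omega> i \<partial>?M)"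
    unfolding market_space_eq by (intro nn_integral_suminf) measurable
  also have "\<dots> \<le> (\<Sum>i. (\<integral>\<^sup>+E. a E i \<partial>?E) * ennreal (\<delta> + Q))"
    by (intro suminf_le g) auto
  also have "\<dots> = (\<Sum>i. (\<integral>\<^sup>+E. a E i \<partial>?E)) * ennreal (\<delta> + Q)"
    by (rule ennreal_suminf_multc)
  also have "\<dots> = ennreal (m * T * (\<delta> + Q))"
    unfolding a_def using expected_arrivals[OF m, of T] T m \<delta> Q by (simp add: ennreal_mult)
  finally have "enn2real (\<integral>\<^sup>+\<omega>. ennreal (?f \<omega>) \<partial>?M) \<le> m * T * (\<delta> + Q)"
    using T m \<delta> Q by (intro enn2real_leI) auto
  then have "(\<integral>\<omega>. ?f \<omega> \<partial>?M) \<le> m * T * (\<delta> + Q)"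
    using integral_le_enn2real_nn_integral[of ?M ?f] by linarith
  then show ?thesis
    using m T by (simp add: greedy_loss_at_def \<delta>_def field_simps)
qed

section \<open>Elementary estimates, choice of parameters and passage to the limit\<close>

text \<open>The concave function \<open>1 - exp (- x)\<close> vanishes at 0, so the slopes of its
  chords from the origin decrease.\<close>

lemma one_minus_exp_over_antimono:
  fixes x y :: real
  assumes "0 < x" "x \<le> y"
  shows "(1 - exp (- y)) / y \<le> (1 - exp (- x)) / x"
proof -
  have "exp (- x) \<le> (1 - x / y) * exp 0 + x / y * exp (- y)"
    using convex_onD[OF exp_convex, of "x / y" 0 "- y"] assms by simp
  then have "x / y * (1 - exp (- y)) \<le> 1 - exp (- x)" by (simp add: algebra_simps)
  then have "x / y * (1 - exp (- y)) / x \<le> (1 - exp (- x)) / x"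
    using assms by (intro divide_right_mono) auto
  then show ?thesis using assms by simp
qed

lemma one_minus_power_le_exp:
  fixes p :: real
  assumes "p \<le> 1"
  shows "(1 - p) ^ n \<le> exp (- p * n)"
proof -
  have "(1 - p) ^ n \<le> exp (- p) ^ n"
    using assms exp_ge_add_one_self[of "- p"] by (intro power_mono) auto
  also have "\<dots> = exp (- p * n)" by (simp add: exp_of_nat_mult[symmetric] mult.commute)
  finally show ?thesis .
qed

lemma loss_bound_tendsto:
  fixes A B a c K e :: real
  assumes "0 < c"
  shows "((\<lambda>m. exp (B / m - A) + m * (exp (a - c * m) / K) + 1 / (m * e\<^sup>2)) \<longlongrightarrow> exp (- A)) at_top"
proof -
  have 1: "((\<lambda>m. exp (B / m - A)) \<longlongrightarrow> exp (- A)) at_top" by real_asymp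
  have "((\<lambda>m. m * exp (a - c * m)) \<longlongrightarrow> 0) at_top" using assms by real_asymp
  then have 2: "((\<lambda>m. m * (exp (a - c * m) / K)) \<longlongrightarrow> 0) at_top"
    using tendsto_mult_left_zero[of _ at_top "1 / K"] by fastforce
  have "((\<lambda>m::real. 1 / m) \<longlongrightarrow> 0) at_top" by real_asymp
  then have 3: "((\<lambda>m. 1 / (m * e\<^sup>2)) \<longlongrightarrow> 0) at_top"
    using tendsto_mult_left_zero[of _ at_top "1 / e\<^sup>2"] by fastforce
  show ?thesis using tendsto_add[OF tendsto_add[OF 1 2] 3] by simp
qed

text \<open>The slack \<open>e\<close> stays fixed while \<open>m\<close> grows. The three terms are
  survival through the matching attempts, the probability of an oversized pool summed over them, and
  too few arrivals in a unit of time. Both \<open>y\<close>, which is \<open>p * z2\<close>, and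
  \<open>K\<close>, which is \<open>1 - \<rho>\<close>, are free of \<open>m\<close>.\<close>

lemma greedy_loss_at_le_explicit:
  fixes d e m T :: real
  assumes \<mu>: "prob_space \<mu>" "sets \<mu> = sets borel" "emeasure \<mu> {0..<1} = 0"
    and d: "0 < d" and e: "0 < e" "e < 1" and m: "d \<le> m" and T: "0 < T"
  defines "y \<equiv> ln 2 + 2 * e * d" and "K \<equiv> 1 - (1 / 2 + (1 - exp (- (e * d)) / 2) / exp (e * d))"
  shows "greedy_loss_at d \<mu> m T \<le>
    exp (d * ((1 - exp (- y)) / y) / m - d * ((1 - exp (- y)) / y) * (1 - e))
      + m * (exp (e * d - e * d * e * m) / K) + 1 / (m * e\<^sup>2)"
proof -
  define H where "H = (1 - exp (- y)) / y"
  define k where "k = nat \<lfloor>(1 - e) * m\<rfloor>"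
  define p where "p = d / m"
  define r where "r = p * H"
  \<comment> \<open>any \<open>b > 1\<close> with \<open>q (b + 1) < 1\<close> would do\<close>
  define b where "b = exp (e * d)"
  \<comment> \<open>This is \<open>exp (- (p * z1))\<close>, bounding the joining probability from
    size \<open>z1\<close> on; together with \<open>b\<close> it satisfies
    \<open>q * b = 1 / 2\<close>.\<close>
  define q where "q = exp (- (e * d)) / 2"
  \<comment> \<open>The estimate \<open>exp (- (p * z))\<close> equals one half at
    \<open>z = m * ln 2 / d\<close>. One margin \<open>e * m\<close> makes the drift strictly
    negative, the second one, in \<open>z2\<close>, makes the tail small.\<close>
  define z1 where "z1 = (ln 2 / d + e) * m"
  define z2 where "z2 = (ln 2 / d + 2 * e) * m"
  define \<rho> where "\<rho> = q * b + (1 - q) / b"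
  have m0: "0 < m" using m d by simp
  have p: "0 \<le> p" "p \<le> 1" using m d by (auto simp: p_def)
  have y: "0 < y" using d e by (simp add: y_def add_pos_pos)
  have H: "0 \<le> H" "H \<le> 1"
    using y exp_ge_add_one_self[of "- y"] by (auto simp: H_def divide_le_eq_1)
  have r01: "0 \<le> r" "r \<le> 1" using p H by (auto simp: r_def mult_le_one)
  have b: "b > 1" using d e by (simp add: b_def)
  have z1: "0 \<le> z1" using d e m0 by (simp add: z1_def)
  have k: "real k \<le> (1 - e) * m" "(1 - e) * m - 1 \<le> real k"
    using e m0 by (auto simp: k_def)
  have qz: "(1 - p) ^ z \<le> q" if "z1 \<le> real z" for z :: nat
  proof -
    have "p * z1 = ln 2 + e * d" using d m0 by (simp add: p_def z1_def field_simps)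
    moreover have "p * z1 \<le> p * z" using p that by (intro mult_left_mono)
    ultimately have "exp (- p * z) \<le> exp (- ln 2 + - (e * d))" by simp
    also have "\<dots> = q" by (simp add: q_def exp_diff exp_minus inverse_eq_divide)
    finally show ?thesis using one_minus_power_le_exp[OF p(2), of z] by linarith
  qed
  have qb: "q * b = 1 / 2" by (simp add: q_def b_def exp_minus)
  have \<rho>K: "1 - \<rho> = K" unfolding \<rho>_def qb K_def by (simp add: q_def b_def)
  have q0: "0 < q" "q < 1 / 2" using d e by (auto simp: q_def)
  \<comment> \<open>With \<open>q * b = 1 / 2\<close> the contraction \<rho> < 1 amounts to
    \<open>2 * q * (1 - q) < 1 / 2\<close>, which is a strictly positive square because q <
    1/2.\<close>
  have "(1 - q) / b = 2 * q * (1 - q)" using qb b by (simp add: field_simps)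
  moreover have "0 < (1 - 2 * q)\<^sup>2" using q0 by simp
  then have "2 * q * (1 - q) < 1 / 2" by (simp add: power2_eq_square algebra_simps)
  ultimately have \<rho>1: "\<rho> < 1" unfolding \<rho>_def qb by simp
  have \<rho>0: "0 \<le> \<rho>" unfolding \<rho>_def qb using q0 b by simp
  have rz: "r \<le> (1 - (1 - p) ^ z) / z" if z: "0 < z" "real z \<le> z2" for z :: nat
  proof -
    have "p * z2 = y" using d m0 by (simp add: p_def z2_def y_def field_simps)
    then have "p * z \<le> y" using p mult_left_mono[OF z(2), of p] by simp
    moreover have pz: "0 < p * z" using d m0 z by (simp add: p_def)
    ultimately have "H \<le> (1 - exp (- (p * z))) / (p * z)"
      unfolding H_def by (intro one_minus_exp_over_antimono)
    then have "r \<le> p * ((1 - exp (- (p * z))) / (p * z))"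
      unfolding r_def using p by (intro mult_left_mono)
    also have "\<dots> = (1 - exp (- (p * z))) / z" using pz by simp
    also have "\<dots> \<le> (1 - (1 - p) ^ z) / z"
      using one_minus_power_le_exp[OF p(2), of z] by (intro divide_right_mono) auto
    finally show ?thesis .
  qed
  define \<beta> where "\<beta> = b powr (z1 + 1 - z2) / (1 - \<rho>)"
  have \<beta>: "0 \<le> \<beta>" using \<rho>1 by (simp add: \<beta>_def)
  have "greedy_loss_at d \<mu> m T \<le> ((1 - r) ^ k + k * \<beta>) + 1 / (m * e\<^sup>2)"
  proof (rule greedy_loss_at_le[OF \<mu> m0 T e(1) k(1)])
    show "0 \<le> (1 - r) ^ k + k * \<beta>" using r01 \<beta> by simp
    fix E X i
    show "(\<integral>\<^sup>+w. indicator {P. i \<in> P} (pool E X w (Suc i + k)) \<partial>choice_space (d / m)) \<le> ennreal ((1 - r) ^ k + k * \<beta>)"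
      unfolding \<beta>_def p_def[symmetric]
      by (rule nn_integral_pool_member_le[OF p b z1 qz _ \<rho>0 \<rho>1 rz r01]) (simp_all add: \<rho>_def)
  qed
  also have "(1 - r) ^ k \<le> exp (d * H / m - d * H * (1 - e))"
  proof -
    have "(1 - r) ^ k \<le> exp (- r * k)" by (rule one_minus_power_le_exp[OF r01(2)])
    \<comment> \<open>Rounding down in \<open>k\<close> loses at most one matching attempt, whence
      the vanishing term \<open>d * H / m\<close>.\<close>
    also have "\<dots> \<le> exp (- (r * ((1 - e) * m - 1)))"
      using mult_left_mono[OF k(2) r01(1)] by simp
    also have "- (r * ((1 - e) * m - 1)) = d * H / m - d * H * (1 - e)"
      using m0 by (simp add: r_def p_def field_simps)
    finally show ?thesis .
  qed
  also have "real k * \<beta> \<le> m * (exp (e * d - e * d * e * m) / K)"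
  proof -
    have "(1 - e) * m \<le> 1 * m" using e m0 by (intro mult_right_mono) auto
    then have "real k \<le> m" using k by simp
    moreover have z: "z1 + 1 - z2 = 1 - e * m" by (simp add: z1_def z2_def algebra_simps)
    have "\<beta> = exp (e * d - e * d * e * m) / K"
      unfolding \<beta>_def \<rho>K z by (simp add: b_def powr_def algebra_simps)
    ultimately show ?thesis using \<beta> by (metis mult_right_mono)
  qed
  finally show ?thesis by (simp add: H_def)
qed

theorem theorem6:
  fixes d :: real and \<mu> :: "ennreal measure"
  assumes "prob_space \<mu>" and "sets \<mu> = sets borel"
    and "emeasure \<mu> {0..<1} = 0"
    and "d \<ge> 2"
  shows "greedy_loss d \<mu> \<le> ereal (exp (- (d / (2 * ln 2))))"
proof (rule ereal_le_epsilon2)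
  \<comment> \<open>Order of choices: \<epsilon> and \<open>d\<close> determine \<open>e\<close>,
    then \<open>m\<close> is taken large, while \<open>T\<close> may be any positive number.\<close>
  fix \<epsilon> :: real assume \<epsilon>: "0 < \<epsilon>"
  have d: "0 < d" using assms by simp
  let ?L = "exp (- (d / (2 * ln 2)))"
  let ?y = "\<lambda>e. ln 2 + 2 * e * d"
  let ?A = "\<lambda>e. d * ((1 - exp (- ?y e)) / ?y e) * (1 - e)"
  have "((\<lambda>e. exp (- ?A e)) \<longlongrightarrow> exp (- ?A 0)) (at_right 0)"
    by (intro tendsto_intros) auto
  \<comment> \<open>At \<open>e = 0\<close> the argument \<open>?y\<close> is \<open>ln 2\<close>
    and \<open>1 - exp (- ln 2)\<close> is one half, which produces the constant
    \<open>d / (2 * ln 2)\<close>.\<close>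
  moreover have "exp (- ?A 0) = ?L" by (simp add: exp_minus)
  ultimately have "eventually (\<lambda>e. exp (- ?A e) < ?L + \<epsilon>) (at_right 0)"
    using \<epsilon> by (intro order_tendstoD(2)) auto
  moreover have "eventually (\<lambda>e. e \<in> {0<..<1}) (at_right (0::real))"
    by (rule eventually_at_right_real) simp
  ultimately have "eventually (\<lambda>e. exp (- ?A e) < ?L + \<epsilon> \<and> e \<in> {0<..<1}) (at_right 0)"
    by (rule eventually_conj)
  then obtain e where e: "exp (- ?A e) < ?L + \<epsilon>" "0 < e" "e < 1"
    using eventually_happens[of _ "at_right (0::real)"] by auto
  let ?K = "1 - (1 / 2 + (1 - exp (- (e * d)) / 2) / exp (e * d))"
  let ?B = "\<lambda>m. exp (d * ((1 - exp (- ?y e)) / ?y e) / m - ?A e)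
      + m * (exp (e * d - e * d * e * m) / ?K) + 1 / (m * e\<^sup>2)"
  have "(?B \<longlongrightarrow> exp (- ?A e)) at_top"
    by (rule loss_bound_tendsto) (use d e in simp)
  then have "eventually (\<lambda>m. ?B m < ?L + \<epsilon>) at_top" using e(1) by (rule order_tendstoD(2))
  then have "eventually (\<lambda>m. ?B m < ?L + \<epsilon> \<and> d \<le> m) at_top"
    using eventually_ge_at_top[of d] by (rule eventually_conj)
  then have "eventually (\<lambda>x. (?B (fst x) < ?L + \<epsilon> \<and> d \<le> fst x) \<and> 0 < snd x) (at_top \<times>\<^sub>F (at_top :: real filter))"
    using eventually_gt_at_top[of "0::real"] by (rule eventually_prodI)
  then have "eventually (\<lambda>(m, T). ereal (greedy_loss_at d \<mu> m T) \<le> ereal ?L + ereal \<epsilon>) (at_top \<times>\<^sub>F at_top)"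
  proof eventually_elim
    case (elim x)
    obtain m T where x: "x = (m, T)" by fastforce
    have "greedy_loss_at d \<mu> m T \<le> ?B m"
      using elim e by (intro greedy_loss_at_le_explicit[OF assms(1-3) d]) (auto simp: x)
    then show ?case using elim by (simp add: x)
  qed
  then show "greedy_loss d \<mu> \<le> ereal ?L + ereal \<epsilon>"
    unfolding greedy_loss_def case_prod_beta' by (intro Limsup_bounded) (simp add: case_prod_beta')
qed

end
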